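(* Let $X$ and $Y$ be infinite totally ordered sets such that there exists a totally positive kernel on $X \times Y$. (i) Let $F : (0,\infty) \to (0,\infty)$. Then $F \circ K$ is totally positive for every totally positive kernel $K : X \times Y \to \mathbb{R}$ if and only if there is $c > 0$ such that $F(x) = cx$ for all $x > 0$. (ii) Let $F : [0,\infty) \to \mathbb{R}$ be non-constant. Then $F \circ K$ is totally non-negative for every totally non-negative kernel $K : X \times Y \to \mathbb{R}$ if and only if there is $c > 0$ such that $F(x) = cx$ for all $x \geq 0$. (iii) Let $F : (0,\infty) \to (0,\infty)$. Then $F \circ K$ is totally positive for every symmetric totally positive kernel $K : X \times X \to \mathbb{R}$ if and only if there is $c > 0$ such that $F(x) = cx$ for all $x > 0$. (iv) Let $F : [0,\infty) \to \mathbb{R}$ be non-constant. Then $F \circ K$ is totally non-negative for every symmetric totally non-negative kernel $K : X \times X \to \mathbb{R}$ if and only if there is $c > 0$ such that $F(x) = cx$ for all $x \geq 0$.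
   Context: For totally ordered sets $X$ and $Y$, a kernel $K : X \times Y \to \mathbb{R}$ is totally non-negative (respectively totally positive) if for every $n \in \mathbb{N}$ and all $x_1 < \cdots < x_n$ in $X$ and $y_1 < \cdots < y_n$ in $Y$ the determinant of $(K(x_i,y_j))_{i,j=1}^n$ is $\geq 0$ (respectively $> 0$). A kernel on $X \times X$ is symmetric if $K(x,y) = K(y,x)$ for all $x,y \in X$. *)

theory Defs
  imports Complex_Main "HOL-Library.FuncSet" "Jordan_Normal_Form.Determinant"
begin

text \<open>A totally ordered set is a subset of a type of class \<open>linorder\<close> with the induced order.
  A kernel is a total function of which only the values on \<open>X \<times> Y\<close> matter. The increasing tuples
  \<open>x\<^sub>1 < \<dots> < x\<^sub>n\<close> are indexed by \<open>0, \<dots>, n - 1\<close>; the case \<open>n = 0\<close> is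
  vacuous, since the empty determinant is \<open>1\<close>.\<close>

definition increasing_tuple :: "nat \<Rightarrow> 'a::linorder set \<Rightarrow> (nat \<Rightarrow> 'a) \<Rightarrow> bool" where
  "increasing_tuple n X x \<longleftrightarrow> x \<in> {..<n} \<rightarrow> X \<and> strict_mono_on {..<n} x"

definition totally_nonneg_kernel ::
  "'a::linorder set \<Rightarrow> 'b::linorder set \<Rightarrow> ('a \<Rightarrow> 'b \<Rightarrow> real) \<Rightarrow> bool" where
  "totally_nonneg_kernel X Y K \<longleftrightarrow>
     (\<forall>n x y. increasing_tuple n X x \<longrightarrow> increasing_tuple n Y y \<longrightarrow>
        det (mat n n (\<lambda>(i, j). K (x i) (y j))) \<ge> 0)"

definition totally_positive_kernel ::
  "'a::linorder set \<Rightarrow> 'b::linorder set \<Rightarrow> ('a \<Rightarrow> 'b \<Rightarrow> real) \<Rightarrow> bool" where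
  "totally_positive_kernel X Y K \<longleftrightarrow>
     (\<forall>n x y. increasing_tuple n X x \<longrightarrow> increasing_tuple n Y y \<longrightarrow>
        det (mat n n (\<lambda>(i, j). K (x i) (y j))) > 0)"

definition symmetric_kernel :: "'a set \<Rightarrow> ('a \<Rightarrow> 'a \<Rightarrow> real) \<Rightarrow> bool" where
  "symmetric_kernel X K \<longleftrightarrow> (\<forall>x\<in>X. \<forall>y\<in>X. K x y = K y x)"

end

theory Submission
  imports Defs
begin

text \<open>
  A totally positive kernel on \<open>X \<times> Y\<close> embeds \<open>X\<close> and \<open>Y\<close> into the reals, so every symmetric totally
  positive kernel on the real line can be pulled back along embeddings that send prescribed points
  to \<open>0, 1, 2, \<dots>\<close>; totally non-negative matrices are pulled back along weakly monotone maps.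
  It remains to study the matrices that arise on the grid \<open>\<nat> \<times> \<nat>\<close>.
  The kernels \<open>r x * r y * exp (t * x * y)\<close> realise every positive \<open>2 \<times> 2\<close> block with positive
  determinant off the diagonal, which forces \<open>F x = c * x powr \<alpha>\<close> for \<open>x > 0\<close>.
  By Cauchy--Binet, kernels \<open>\<Sum>k. w k * \<Psi> k x * \<Psi> k y\<close> with \<open>\<Psi>\<close> obtained from Gaussians by adding to
  some \<open>\<Psi> k\<close> its successor are totally positive, and their limits on the grid include two symmetric matrices.
  The tridiagonal one with rows \<open>(1, 1, 0), (1, 2, 1), (0, 1, 1)\<close> excludes \<open>\<alpha> < 1\<close>, as well as a jump of \<open>F\<close> at \<open>0\<close>.
  The matrix \<open>1 + s * (i * j + max 0 (i - 2) * max 0 (j - 2))\<close>, \<open>0 \<le> i, j \<le> 4\<close>, excludes \<open>\<alpha> > 1\<close>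
  for small \<open>s\<close>: its minor with rows \<open>0, 1, 2, 3\<close> and columns \<open>0, 2, 3, 4\<close> vanishes, while the same minor of
  the entrywise power is \<open>- 4 * \<alpha> ^ 3 * (\<alpha> - 1) * s ^ 4\<close> to leading order.
\<close>

section \<open>Determinants\<close>

text \<open>Multilinearity in the rows: row \<open>i\<close> chooses one summand \<open>h i\<close>,
  and a non-injective choice repeats a row. The index set is arbitrary because Cauchy-Binet reads
  the expansion forwards for \<open>{..<N}\<close> and backwards for each of its subsets of size
  \<open>n\<close>.\<close>

lemma det_sum_products_expand:
  fixes f :: "nat \<Rightarrow> 'k \<Rightarrow> 'a::comm_ring_1" and g :: "'k \<Rightarrow> nat \<Rightarrow> 'a"
  assumes "finite T"
  shows "det (mat n n (\<lambda>(i, j). \<Sum>k\<in>T. f i k * g k j)) =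
    (\<Sum>h\<in>{h \<in> {..<n} \<rightarrow>\<^sub>E T. inj_on h {..<n}}.
       (\<Prod>i<n. f i (h i)) * det (mat n n (\<lambda>(i, j). g (h i) j)))"
proof -
  let ?P = "{p. p permutes {0..<n}}"
  let ?D = "\<lambda>h. (\<Prod>i<n. f i (h i)) * det (mat n n (\<lambda>(i, j). g (h i) j))"
  have "det (mat n n (\<lambda>(i, j). \<Sum>k\<in>T. f i k * g k j)) =
      (\<Sum>p\<in>?P. signof p * (\<Prod>i\<in>{0..<n}. \<Sum>k\<in>T. f i k * g k (p i)))"
    by (subst det_def'[of _ n]) (auto intro!: sum.cong arg_cong2[where f = "(*)"] prod.cong)
  also have "\<dots> = (\<Sum>p\<in>?P. signof p * (\<Sum>h\<in>{..<n} \<rightarrow>\<^sub>E T. \<Prod>i<n. f i (h i) * g (h i) (p i)))"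
    by (intro sum.cong refl arg_cong2[where f = "(*)"])
      (simp add: lessThan_atLeast0 prod_sum_PiE[OF _ assms])
  also have "\<dots> = (\<Sum>h\<in>{..<n} \<rightarrow>\<^sub>E T. \<Sum>p\<in>?P. signof p * (\<Prod>i<n. f i (h i) * g (h i) (p i)))"
    by (subst sum.swap) (simp add: sum_distrib_left)
  also have "\<dots> = (\<Sum>h\<in>{..<n} \<rightarrow>\<^sub>E T. ?D h)"
  proof (intro sum.cong refl)
    fix h
    have "det (mat n n (\<lambda>(i, j). g (h i) j)) = (\<Sum>p\<in>?P. signof p * (\<Prod>i<n. g (h i) (p i)))"
      by (subst det_def'[of _ n])
        (auto intro!: sum.cong arg_cong2[where f = "(*)"] prod.cong simp: lessThan_atLeast0)
    then show "(\<Sum>p\<in>?P. signof p * (\<Prod>i<n. f i (h i) * g (h i) (p i))) = ?D h"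
      by (simp add: sum_distrib_left prod.distrib algebra_simps)
  qed
  also have "\<dots> = (\<Sum>h\<in>{h \<in> {..<n} \<rightarrow>\<^sub>E T. inj_on h {..<n}}. ?D h)"
  proof (rule sum.mono_neutral_right)
    show "\<forall>h\<in>({..<n} \<rightarrow>\<^sub>E T) - {h \<in> {..<n} \<rightarrow>\<^sub>E T. inj_on h {..<n}}. ?D h = 0"
    proof
      fix h assume "h \<in> ({..<n} \<rightarrow>\<^sub>E T) - {h \<in> {..<n} \<rightarrow>\<^sub>E T. inj_on h {..<n}}"
      then obtain a b where ab: "a < n" "b < n" "a \<noteq> b" "h a = h b"
        by (auto simp: inj_on_def)
      have "det (mat n n (\<lambda>(i, j). g (h i) j)) = 0"
        by (rule det_identical_rows[of _ n a b]) (use ab in auto)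
      then show "?D h = 0" by simp
    qed
  qed (use assms in \<open>auto intro: finite_PiE\<close>)
  finally show ?thesis .
qed

lemma det_mat_cong:
  assumes "\<And>i j. i < n \<Longrightarrow> j < n \<Longrightarrow> f i j = g i j"
  shows "det (mat n n (\<lambda>(i, j). f i j)) = det (mat n n (\<lambda>(i, j). g i j))"
  by (rule arg_cong[where f = det]) (use assms in \<open>auto intro!: eq_matI\<close>)

text \<open>Injective choices are grouped by their image \<open>S\<close>. The group of
  \<open>S\<close> is the expansion of the determinant of a product of two square matrices, so its
  sum factorises.\<close>

theorem Cauchy_Binet:
  fixes f :: "nat \<Rightarrow> nat \<Rightarrow> 'a::comm_ring_1" and g :: "nat \<Rightarrow> nat \<Rightarrow> 'a"
  shows "det (mat n n (\<lambda>(i, j). \<Sum>k<N. f i k * g k j)) =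
    (\<Sum>S\<in>{S. S \<subseteq> {..<N} \<and> card S = n}.
       det (mat n n (\<lambda>(i, j). f i (sorted_list_of_set S ! j))) *
       det (mat n n (\<lambda>(i, j). g (sorted_list_of_set S ! i) j)))"
proof -
  let ?C = "{S. S \<subseteq> {..<N} \<and> card S = n}"
  let ?I = "\<lambda>T. {h \<in> {..<n} \<rightarrow>\<^sub>E T. inj_on h {..<n}}"
  let ?D = "\<lambda>h. (\<Prod>i<n. f i (h i)) * det (mat n n (\<lambda>(i, j). g (h i) j))"
  have fin: "finite ?C" by (rule finite_subset[of _ "Pow {..<N}"]) auto
  have finI: "finite (?I {..<N})"
    by (rule finite_subset[of _ "{..<n} \<rightarrow>\<^sub>E {..<N}"]) (auto intro: finite_PiE)
  have "det (mat n n (\<lambda>(i, j). \<Sum>k<N. f i k * g k j)) = (\<Sum>h\<in>?I {..<N}. ?D h)"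
    by (rule det_sum_products_expand) simp
  also have "\<dots> = (\<Sum>S\<in>?C. \<Sum>h\<in>{h. h \<in> ?I {..<N} \<and> h ` {..<n} = S}. ?D h)"
    by (rule sum.group[OF finI fin, where g = "\<lambda>h. h ` {..<n}", symmetric])
      (auto simp: card_image PiE_iff)
  also have "\<dots> = (\<Sum>S\<in>?C. \<Sum>h\<in>?I S. ?D h)"
  proof (rule sum.cong[OF refl])
    fix S assume S: "S \<in> ?C"
    then have "finite S" by (auto intro: finite_subset)
    then have "h ` {..<n} = S" if "h \<in> ?I S" for h
      using that S by (intro card_subset_eq) (auto simp: card_image)
    then have "{h. h \<in> ?I {..<N} \<and> h ` {..<n} = S} = ?I S"
      using S by (auto simp: PiE_iff)
    then show "(\<Sum>h\<in>{h. h \<in> ?I {..<N} \<and> h ` {..<n} = S}. ?D h) = (\<Sum>h\<in>?I S. ?D h)"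
      by (simp only:)
  qed
  also have "\<dots> = (\<Sum>S\<in>?C. det (mat n n (\<lambda>(i, j). f i (sorted_list_of_set S ! j))) *
       det (mat n n (\<lambda>(i, j). g (sorted_list_of_set S ! i) j)))"
  proof (rule sum.cong[OF refl])
    fix S assume S: "S \<in> ?C"
    then have fS: "finite S" by (auto intro: finite_subset)
    let ?e = "\<lambda>i. sorted_list_of_set S ! i"
    have bij: "bij_betw ?e {..<n} S"
      using S fS by (intro bij_betw_nth) auto
    have "(\<Sum>h\<in>?I S. ?D h) = det (mat n n (\<lambda>(i, j). \<Sum>k\<in>S. f i k * g k j))"
      by (rule det_sum_products_expand[symmetric, OF fS])
    also have "\<dots> = det (mat n n (\<lambda>(i, j). \<Sum>l<n. f i (?e l) * g (?e l) j))"
      by (simp add: sum.reindex_bij_betw[OF bij, symmetric])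
    also have "mat n n (\<lambda>(i, j). \<Sum>l<n. f i (?e l) * g (?e l) j) =
        mat n n (\<lambda>(i, j). f i (?e j)) * mat n n (\<lambda>(i, j). g (?e i) j)"
      by (rule eq_matI) (auto simp: scalar_prod_def lessThan_atLeast0)
    also have "det \<dots> = det (mat n n (\<lambda>(i, j). f i (?e j))) * det (mat n n (\<lambda>(i, j). g (?e i) j))"
      by (rule det_mult) auto
    finally show "(\<Sum>h\<in>?I S. ?D h) = \<dots>" .
  qed
  finally show ?thesis .
qed

text \<open>The coefficients are the cofactors along column \<open>m\<close>, which do not see the
  entries of that column.\<close>

lemma det_column_linear:
  fixes B :: "nat \<Rightarrow> nat \<Rightarrow> 'a::comm_ring_1"
  assumes "m < n"
  obtains C where "\<And>v. det (mat n n (\<lambda>(i, j). if j = m then v i else B i j)) = (\<Sum>i<n. v i * C i)"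
proof
  fix v :: "nat \<Rightarrow> 'a"
  let ?M = "\<lambda>v. mat n n (\<lambda>(i, j). if j = m then v i else B i j)"
  have "mat_delete (?M v) i m = mat_delete (?M (\<lambda>_. 0)) i m" if "i < n" for i
    using that assms by (intro eq_matI) (auto simp: mat_delete_def)
  then have "cofactor (?M v) i m = cofactor (?M (\<lambda>_. 0)) i m" if "i < n" for i
    using that by (simp add: cofactor_def)
  then show "det (?M v) = (\<Sum>i<n. v i * cofactor (?M (\<lambda>_. 0)) i m)"
    using assms by (subst laplace_expansion_column[of _ n m]) (auto intro!: sum.cong)
qed

text \<open>Subtracting from every column its left neighbour, which is multiplication by the
  unitriangular \<open>?U\<close>, turns the first row into \<open>(1, 0, ..., 0)\<close>.\<close>

lemma det_first_row_one:
  fixes h :: "nat \<Rightarrow> nat \<Rightarrow> 'a::comm_ring_1"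
  shows "det (mat (Suc n) (Suc n) (\<lambda>(i, j). if i = 0 then 1 else h i j)) =
    det (mat n n (\<lambda>(i, j). h (Suc i) (Suc j) - h (Suc i) j))"
proof -
  let ?A = "mat (Suc n) (Suc n) (\<lambda>(i, j). if i = 0 then 1 else h i j)"
  let ?U = "mat (Suc n) (Suc n) (\<lambda>(i, j). if i = j then 1 else if Suc i = j then - 1 else 0 :: 'a)"
  let ?B = "mat (Suc n) (Suc n)
    (\<lambda>(i, j). if j = 0 then ?A $$ (i, 0) else ?A $$ (i, j) - ?A $$ (i, j - 1))"
  have U: "det ?U = 1"
    by (subst det_upper_triangular[of _ "Suc n"])
      (auto simp: upper_triangular_def prod_list_diag_prod)
  have AU: "?A * ?U = ?B"
  proof (rule eq_matI)
    fix i j assume "i < dim_row ?B" "j < dim_col ?B"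
    then have ij: "i < Suc n" "j < Suc n" by auto
    have "(?A * ?U) $$ (i, j) = (\<Sum>k<Suc n. ?A $$ (i, k) * (if k = j then 1 else if Suc k = j then - 1 else 0))"
      using ij by (auto simp: scalar_prod_def lessThan_atLeast0 simp del: sum.op_ivl_Suc intro!: sum.cong)
    also have "\<dots> = (\<Sum>k<Suc n. (if k = j then ?A $$ (i, k) else 0) - (if Suc k = j then ?A $$ (i, k) else 0))"
      by (intro sum.cong) auto
    also have "\<dots> = (\<Sum>k<Suc n. if k = j then ?A $$ (i, k) else 0) -
        (\<Sum>k<Suc n. if Suc k = j then ?A $$ (i, k) else 0)"
      by (simp add: sum_subtractf del: sum.lessThan_Suc)
    also have "(\<Sum>k<Suc n. if k = j then ?A $$ (i, k) else 0) = ?A $$ (i, j)"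
      using ij by (subst sum.delta) auto
    also have "(\<Sum>k<Suc n. if Suc k = j then ?A $$ (i, k) else 0) = (if j = 0 then 0 else ?A $$ (i, j - 1))"
    proof (cases j)
      case (Suc j')
      then show ?thesis using ij by (subst sum.cong[OF refl, of _ _ "\<lambda>k. if k = j' then ?A $$ (i, k) else 0"])
          (auto simp del: sum.lessThan_Suc simp: sum.delta)
    qed simp
    finally show "(?A * ?U) $$ (i, j) = ?B $$ (i, j)" using ij by auto
  qed auto
  have "det ?A = det ?B"
    using det_mult[of ?A "Suc n" ?U] U AU by simp
  also have "\<dots> = (\<Sum>j<Suc n. ?B $$ (0, j) * cofactor ?B 0 j)"
    by (rule laplace_expansion_row) auto
  also have "\<dots> = ?B $$ (0, 0) * cofactor ?B 0 0"
    by (subst sum.lessThan_Suc_shift) simp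
  also have "\<dots> = det (mat_delete ?B 0 0)" by (simp add: cofactor_def)
  also have "mat_delete ?B 0 0 = mat n n (\<lambda>(i, j). h (Suc i) (Suc j) - h (Suc i) j)"
    by (rule eq_matI) (auto simp: mat_delete_def)
  finally show ?thesis .
qed

lemma det_scale_rows_columns:
  fixes M :: "nat \<Rightarrow> nat \<Rightarrow> 'a::comm_ring_1"
  shows "det (mat n n (\<lambda>(i, j). r i * s j * M i j)) =
    (\<Prod>i<n. r i) * (\<Prod>j<n. s j) * det (mat n n (\<lambda>(i, j). M i j))"
proof -
  have s: "(\<Prod>i<n. s (p i)) = (\<Prod>j<n. s j)" if "p permutes {0..<n}" for p
    using prod.permute[OF that, of s] by (simp add: lessThan_atLeast0 comp_def)
  show ?thesis
    unfolding det_def'[OF mat_carrier] sum_distrib_left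
    by (intro sum.cong refl)
      (auto simp: prod.distrib s[unfolded lessThan_atLeast0] lessThan_atLeast0 mult_ac)
qed

lemma tendsto_det:
  fixes M :: "'c \<Rightarrow> nat \<Rightarrow> nat \<Rightarrow> real"
  assumes "\<And>i j. i < n \<Longrightarrow> j < n \<Longrightarrow> ((\<lambda>t. M t i j) \<longlongrightarrow> L i j) F"
  shows "((\<lambda>t. det (mat n n (\<lambda>(i, j). M t i j))) \<longlongrightarrow> det (mat n n (\<lambda>(i, j). L i j))) F"
proof -
  have eq: "det (mat n n (\<lambda>(i, j). A i j)) =
      (\<Sum>p\<in>{p. p permutes {0..<n}}. signof p * (\<Prod>i\<in>{0..<n}. A i (p i)))" for A :: "nat \<Rightarrow> nat \<Rightarrow> real"
    by (subst det_def'[of _ n]) (auto intro!: sum.cong arg_cong2[where f = "(*)"] prod.cong)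
  show ?thesis unfolding eq
    by (intro tendsto_sum tendsto_mult tendsto_const tendsto_prod assms) auto
qed

section \<open>Explicit determinants of small size\<close>

lemma det_mat_1: "det (mat (Suc 0) (Suc 0) f) = f (0, 0)"
  by (subst det_single) auto

lemma det_mat_2:
  fixes f :: "nat \<times> nat \<Rightarrow> 'a::comm_ring_1"
  shows "det (mat 2 2 f) = f (0, 0) * f (1, 1) - f (0, 1) * f (1, 0)"
proof -
  have "mat_delete (mat 2 2 f) 0 k = mat (Suc 0) (Suc 0) (\<lambda>(i, j). f (Suc i, if j < k then j else Suc j))" for k
    by (rule eq_matI) (auto simp: mat_delete_def)
  then show ?thesis
    by (subst laplace_expansion_row[of _ 2 0])
      (simp_all add: cofactor_def det_mat_1 lessThan_nat_numeral lessThan_Suc)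
qed

lemma det_mat_3:
  fixes f :: "nat \<times> nat \<Rightarrow> 'a::comm_ring_1"
  shows "det (mat 3 3 f) =
    f (0, 0) * (f (1, 1) * f (2, 2) - f (1, 2) * f (2, 1))
    - f (0, 1) * (f (1, 0) * f (2, 2) - f (1, 2) * f (2, 0))
    + f (0, 2) * (f (1, 0) * f (2, 1) - f (1, 1) * f (2, 0))"
proof -
  have "mat_delete (mat 3 3 f) 0 k = mat 2 2 (\<lambda>(i, j). f (Suc i, if j < k then j else Suc j))" for k
    by (rule eq_matI) (auto simp: mat_delete_def)
  then show ?thesis
    by (subst laplace_expansion_row[of _ 3 0])
      (simp_all add: cofactor_def det_mat_2 lessThan_nat_numeral lessThan_Suc numeral_2_eq_2[symmetric]
        algebra_simps)
qed

section \<open>Totally positive kernels\<close>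

lemma strict_mono_on_nth_sorted_list_of_set:
  assumes "finite S"
  shows "strict_mono_on {..<card S} (nth (sorted_list_of_set S))"
  using assms by (intro strict_mono_onI) (auto intro: sorted_wrt_nth_less[OF strict_sorted_list_of_set])

text \<open>The mean value theorem is applied to one column at a time, since the determinant is linear in each.\<close>

lemma det_difference_columns_pos:
  fixes f f' :: "nat \<Rightarrow> real \<Rightarrow> real"
  assumes "\<And>j. j < n \<Longrightarrow> y j < y (Suc j)"
    and "\<And>i t. (f i has_real_derivative f' i t) (at t)"
    and "\<And>\<xi>. (\<And>j. j < n \<Longrightarrow> y j < \<xi> j \<and> \<xi> j < y (Suc j)) \<Longrightarrow>
      det (mat n n (\<lambda>(i, j). f' i (\<xi> j))) > 0"
  shows "det (mat n n (\<lambda>(i, j). f i (y (Suc j)) - f i (y j))) > 0"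
proof -
  \<comment> \<open>A hybrid matrix: differences in the first \<open>m\<close> columns, derivatives
    at free intermediate points in the others. The induction keeps \<xi> arbitrary because the mean
    value theorem dictates the point of column \<open>m\<close>.\<close>
  let ?d = "\<lambda>m \<xi>. det (mat n n (\<lambda>(i, j). if j < m then f i (y (Suc j)) - f i (y j) else f' i (\<xi> j)))"
  have "(\<forall>j<n. y j < \<xi> j \<and> \<xi> j < y (Suc j)) \<longrightarrow> ?d m \<xi> > 0" if "m \<le> n" for m \<xi>
    using that
  proof (induction m arbitrary: \<xi>)
    case 0
    then show ?case using assms(3)[of \<xi>] by auto
  next
    case (Suc m)
    show ?case
    proof
      assume \<xi>: "\<forall>j<n. y j < \<xi> j \<and> \<xi> j < y (Suc j)"
      let ?B = "\<lambda>i j. if j < m then f i (y (Suc j)) - f i (y j) else f' i (\<xi> j)"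
      from Suc.prems have "m < n" by simp
      then obtain C where C: "\<And>v. det (mat n n (\<lambda>(i, j). if j = m then v i else ?B i j)) = (\<Sum>i<n. v i * C i)"
        using det_column_linear[of m n ?B] by blast
      let ?g = "\<lambda>t. \<Sum>i<n. f i t * C i"
      have "\<exists>z. y m < z \<and> z < y (Suc m) \<and>
          ?g (y (Suc m)) - ?g (y m) = (y (Suc m) - y m) * (\<Sum>i<n. f' i z * C i)"
        using assms(1)[OF \<open>m < n\<close>]
        by (intro MVT2) (auto intro!: derivative_eq_intros assms(2))
      then obtain z where z: "y m < z" "z < y (Suc m)"
        "?g (y (Suc m)) - ?g (y m) = (y (Suc m) - y m) * (\<Sum>i<n. f' i z * C i)" by blast
      have "(\<Sum>i<n. f' i z * C i) = ?d m (\<xi>(m := z))"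
        unfolding C[symmetric] by (rule det_mat_cong) auto
      moreover have "\<dots> > 0"
        using Suc.IH[of "\<xi>(m := z)"] Suc.prems \<xi> z by auto
      moreover have "?d (Suc m) \<xi> = (\<Sum>i<n. (f i (y (Suc m)) - f i (y m)) * C i)"
        unfolding C[symmetric] by (rule det_mat_cong) auto
      moreover have "\<dots> = ?g (y (Suc m)) - ?g (y m)"
        by (simp add: algebra_simps sum_subtractf)
      ultimately show "?d (Suc m) \<xi> > 0" using z by simp
    qed
  qed
  \<comment> \<open>For \<open>m = n\<close> the points no longer occur in the matrix; the midpoints
    are just an admissible choice.\<close>
  from this[of n "\<lambda>j. (y j + y (Suc j)) / 2"] assms(1)
  have "?d n (\<lambda>j. (y j + y (Suc j)) / 2) > 0" by (auto simp: field_simps)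
  also have "?d n (\<lambda>j. (y j + y (Suc j)) / 2) = det (mat n n (\<lambda>(i, j). f i (y (Suc j)) - f i (y j)))"
    by (rule det_mat_cong) auto
  finally show ?thesis .
qed

text \<open>Induction on \<open>n\<close>: taking \<open>exp (x 0 * y j)\<close> out of the columns
  makes the first row constant, column differences reduce the size by one, and their derivatives
  form a smaller exponential matrix with positive row factors \<open>a i\<close>.\<close>

lemma det_exp_pos:
  fixes x y :: "nat \<Rightarrow> real"
  assumes "strict_mono_on {..<n} x" "strict_mono_on {..<n} y"
  shows "det (mat n n (\<lambda>(i, j). exp (x i * y j))) > 0"
  using assms
proof (induction n arbitrary: x y)
  case (Suc n)
  define a where "a i = x (Suc i) - x 0" for i
  have a_pos: "a i > 0" if "i < n" for i
    using strict_mono_onD[OF Suc.prems(1), of 0 "Suc i"] that by (simp add: a_def)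
  have a_mono: "strict_mono_on {..<n} a"
    using strict_mono_onD[OF Suc.prems(1)] by (auto simp: a_def strict_mono_on_def)
  have "det (mat n n (\<lambda>(i, j). exp (a i * y (Suc j)) - exp (a i * y j))) > 0"
  proof (rule det_difference_columns_pos[where f = "\<lambda>i t. exp (a i * t)" and f' = "\<lambda>i t. a i * 1 * exp (a i * t)"])
    show "y j < y (Suc j)" if "j < n" for j
      using strict_mono_onD[OF Suc.prems(2), of j "Suc j"] that by simp
    show "((\<lambda>t. exp (a i * t)) has_real_derivative a i * 1 * exp (a i * t)) (at t)" for i t
      by (auto intro!: derivative_eq_intros)
    fix \<xi> assume \<xi>: "\<And>j. j < n \<Longrightarrow> y j < \<xi> j \<and> \<xi> j < y (Suc j)"
    \<comment> \<open>The points lie in consecutive disjoint intervals.\<close>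
    have "strict_mono_on {..<n} \<xi>"
    proof (rule strict_mono_onI)
      fix i j assume ij: "i \<in> {..<n}" "j \<in> {..<n}" "i < j"
      then have "y (Suc i) \<le> y j"
        using strict_mono_onD[OF Suc.prems(2), of "Suc i" j] by (cases "Suc i = j") auto
      with \<xi>[of i] \<xi>[of j] ij show "\<xi> i < \<xi> j" by auto
    qed
    from Suc.IH[OF a_mono this] show "det (mat n n (\<lambda>(i, j). a i * 1 * exp (a i * \<xi> j))) > 0"
      using a_pos by (subst det_scale_rows_columns) (auto intro!: mult_pos_pos prod_pos)
  qed
  also have "det (mat n n (\<lambda>(i, j). exp (a i * y (Suc j)) - exp (a i * y j))) =
      det (mat (Suc n) (Suc n) (\<lambda>(i, j). if i = 0 then 1 else exp ((x i - x 0) * y j)))"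
    by (simp add: det_first_row_one a_def)
  also have "\<dots> = det (mat (Suc n) (Suc n) (\<lambda>(i, j). exp ((x i - x 0) * y j)))"
    by (rule det_mat_cong) auto
  finally have pos: "\<dots> > 0" .
  have "det (mat (Suc n) (Suc n) (\<lambda>(i, j). exp (x i * y j))) =
      det (mat (Suc n) (Suc n) (\<lambda>(i, j). 1 * exp (x 0 * y j) * exp ((x i - x 0) * y j)))"
    by (rule det_mat_cong) (simp add: algebra_simps flip: exp_add)
  also have "\<dots> > 0"
    unfolding det_scale_rows_columns using pos by (auto intro!: mult_pos_pos prod_pos)
  finally show ?case .
qed simp

section \<open>Operations that preserve total positivity\<close>

lemma totally_positive_kernel_scale:
  assumes "totally_positive_kernel X Y K" "\<And>x. x \<in> X \<Longrightarrow> r x > 0" "\<And>y. y \<in> Y \<Longrightarrow> s y > 0"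
  shows "totally_positive_kernel X Y (\<lambda>x y. r x * s y * K x y)"
  using assms unfolding totally_positive_kernel_def increasing_tuple_def
  by (auto simp: det_scale_rows_columns Pi_iff intro!: mult_pos_pos prod_pos)

lemma totally_positive_kernel_exp:
  "t > 0 \<Longrightarrow> totally_positive_kernel X Y (\<lambda>x y :: real. exp (t * x * y))"
  unfolding totally_positive_kernel_def increasing_tuple_def
  using det_exp_pos[where x = "\<lambda>i. t * x i" for x] by (auto simp: strict_mono_on_def)

lemma totally_positive_kernel_pullback:
  assumes "totally_positive_kernel X Y K" "\<phi> \<in> X' \<rightarrow> X" "\<psi> \<in> Y' \<rightarrow> Y"
    and "strict_mono_on X' \<phi>" "strict_mono_on Y' \<psi>"
  shows "totally_positive_kernel X' Y' (\<lambda>x y. K (\<phi> x) (\<psi> y))"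
  unfolding totally_positive_kernel_def
proof (intro allI impI)
  fix n x y assume "increasing_tuple n X' x" "increasing_tuple n Y' y"
  then have "increasing_tuple n X (\<lambda>i. \<phi> (x i))" "increasing_tuple n Y (\<lambda>i. \<psi> (y i))"
    using assms(2-) by (auto simp: increasing_tuple_def strict_mono_on_def Pi_iff)
  with assms(1) show "det (mat n n (\<lambda>(i, j). K (\<phi> (x i)) (\<psi> (y j)))) > 0"
    unfolding totally_positive_kernel_def by blast
qed

text \<open>By Cauchy-Binet each minor of a partial sum is a sum of products of positive minors.
  Strictness survives the limit because the term of \<open>{..<n}\<close> occurs in every partial
  sum with \<open>N \<ge> n\<close> and bounds it from below.\<close>

lemma totally_positive_kernel_suminf:
  fixes \<Psi> :: "nat \<Rightarrow> 'a::linorder \<Rightarrow> real" and \<Phi> :: "nat \<Rightarrow> 'b::linorder \<Rightarrow> real"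
  assumes \<Psi>: "totally_positive_kernel X UNIV (\<lambda>x k. \<Psi> k x)"
    and \<Phi>: "totally_positive_kernel Y UNIV (\<lambda>y k. \<Phi> k y)"
    and w: "\<And>k. w k > 0"
    and summable: "\<And>x y. x \<in> X \<Longrightarrow> y \<in> Y \<Longrightarrow> summable (\<lambda>k. w k * \<Psi> k x * \<Phi> k y)"
  shows "totally_positive_kernel X Y (\<lambda>x y. \<Sum>k. w k * \<Psi> k x * \<Phi> k y)"
  unfolding totally_positive_kernel_def
proof (intro allI impI)
  fix n x y assume x: "increasing_tuple n X x" and y: "increasing_tuple n Y y"
  let ?D = "\<lambda>N. det (mat n n (\<lambda>(i, j). \<Sum>k<N. w k * \<Psi> k (x i) * \<Phi> k (y j)))"
  let ?e = "\<lambda>S j. sorted_list_of_set S ! j"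
  let ?t = "\<lambda>S. det (mat n n (\<lambda>(i, j). w (?e S j) * \<Psi> (?e S j) (x i))) *
    det (mat n n (\<lambda>(i, j). \<Phi> (?e S i) (y j)))"
  have t_pos: "?t S > 0" if "finite S" "card S = n" for S
  proof -
    have e: "increasing_tuple n UNIV (?e S)"
      using strict_mono_on_nth_sorted_list_of_set[OF that(1)] that(2) by (simp add: increasing_tuple_def)
    have "det (mat n n (\<lambda>(i, j). \<Psi> (?e S j) (x i))) > 0"
      using \<Psi> x e unfolding totally_positive_kernel_def by blast
    then have "det (mat n n (\<lambda>(i, j). 1 * w (?e S j) * \<Psi> (?e S j) (x i))) > 0"
      unfolding det_scale_rows_columns using w by (auto intro!: mult_pos_pos prod_pos)
    moreover have "det (mat n n (\<lambda>(i, j). \<Phi> (?e S j) (y i))) > 0"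
      using \<Phi> y e unfolding totally_positive_kernel_def by blast
    moreover have "mat n n (\<lambda>(i, j). \<Phi> (?e S i) (y j)) = (mat n n (\<lambda>(i, j). \<Phi> (?e S j) (y i)))\<^sup>T"
      by (rule eq_matI) auto
    ultimately show ?thesis by (simp add: det_transpose[where n = n])
  qed
  have lower: "?D N \<ge> ?t {..<n}" if "N \<ge> n" for N
  proof -
    let ?C = "{S. S \<subseteq> {..<N} \<and> card S = n}"
    have fin: "finite ?C" by (rule finite_subset[of _ "Pow {..<N}"]) auto
    have "?t {..<n} \<le> (\<Sum>S\<in>?C. ?t S)"
    proof (rule member_le_sum[OF _ _ fin])
      show "{..<n} \<in> ?C" using that by auto
      show "0 \<le> ?t S" if "S \<in> ?C - {{..<n}}" for S
        using that by (intro less_imp_le t_pos) (auto intro: finite_subset)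
    qed
    also have "\<dots> = ?D N" by (rule Cauchy_Binet[symmetric])
    finally show ?thesis .
  qed
  have lim: "?D \<longlonglongrightarrow> det (mat n n (\<lambda>(i, j). \<Sum>k. w k * \<Psi> k (x i) * \<Phi> k (y j)))"
    using x y by (intro tendsto_det summable_LIMSEQ summable) (auto simp: increasing_tuple_def Pi_iff)
  have "?t {..<n} \<le> det (mat n n (\<lambda>(i, j). \<Sum>k. w k * \<Psi> k (x i) * \<Phi> k (y j)))"
    by (rule tendsto_lowerbound[OF lim]) (auto intro!: eventually_sequentiallyI[of n] lower)
  with t_pos[of "{..<n}"] show "0 < det (mat n n (\<lambda>(i, j). \<Sum>k. w k * \<Psi> k (x i) * \<Phi> k (y j)))"
    by simp
qed

text \<open>With \<open>x\<close> indexing rows and \<open>k\<close> columns, this is right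
  multiplication by an elementary bidiagonal matrix.\<close>

definition add_next :: "nat \<Rightarrow> (nat \<Rightarrow> 'a \<Rightarrow> real) \<Rightarrow> nat \<Rightarrow> 'a \<Rightarrow> real" where
  "add_next k \<Psi> = \<Psi>(k := (\<lambda>x. \<Psi> k x + \<Psi> (Suc k) x))"

text \<open>Linearity in the column with index \<open>k\<close> splits a minor into the old one and
  the one with \<open>k\<close> replaced by \<open>Suc k\<close>; the latter has a repeated column
  or is again a minor with increasing indices.\<close>

lemma totally_positive_kernel_add_next:
  assumes \<Psi>: "totally_positive_kernel X UNIV (\<lambda>x l. \<Psi> l x)"
  shows "totally_positive_kernel X UNIV (\<lambda>x l. add_next k \<Psi> l x)"
  unfolding totally_positive_kernel_def
proof (intro allI impI)
  fix n x and \<kappa> :: "nat \<Rightarrow> nat" assume x: "increasing_tuple n X x" and \<kappa>: "increasing_tuple n UNIV \<kappa>"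
  have pos: "det (mat n n (\<lambda>(i, j). \<Psi> (\<kappa>' j) (x i))) > 0" if "increasing_tuple n UNIV \<kappa>'" for \<kappa>'
    using \<Psi> x that unfolding totally_positive_kernel_def by blast
  show "0 < det (mat n n (\<lambda>(i, j). add_next k \<Psi> (\<kappa> j) (x i)))"
  proof (cases "\<exists>m<n. \<kappa> m = k")
    case False
    then have "det (mat n n (\<lambda>(i, j). add_next k \<Psi> (\<kappa> j) (x i))) = det (mat n n (\<lambda>(i, j). \<Psi> (\<kappa> j) (x i)))"
      by (intro det_mat_cong) (auto simp: add_next_def)
    with pos[OF \<kappa>] show ?thesis by simp
  next
    case True
    then obtain m where m: "m < n" "\<kappa> m = k" by blast
    have other: "\<kappa> j \<noteq> k" if "j < n" "j \<noteq> m" for j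
      using \<kappa> m that by (auto simp: increasing_tuple_def dest!: strict_mono_on_imp_inj_on inj_onD)
    obtain C where C: "\<And>v. det (mat n n (\<lambda>(i, j). if j = m then v i else \<Psi> (\<kappa> j) (x i))) = (\<Sum>i<n. v i * C i)"
      using det_column_linear[OF m(1), of "\<lambda>i j. \<Psi> (\<kappa> j) (x i)"] by blast
    have "det (mat n n (\<lambda>(i, j). add_next k \<Psi> (\<kappa> j) (x i))) =
        (\<Sum>i<n. (\<Psi> k (x i) + \<Psi> (Suc k) (x i)) * C i)"
      unfolding C[symmetric] using m other by (intro det_mat_cong) (auto simp: add_next_def)
    also have "\<dots> = (\<Sum>i<n. \<Psi> k (x i) * C i) + (\<Sum>i<n. \<Psi> (Suc k) (x i) * C i)"
      by (simp add: algebra_simps sum.distrib)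
    also have "(\<Sum>i<n. \<Psi> k (x i) * C i) = det (mat n n (\<lambda>(i, j). \<Psi> (\<kappa> j) (x i)))"
      unfolding C[symmetric] using m by (intro det_mat_cong) auto
    also have "(\<Sum>i<n. \<Psi> (Suc k) (x i) * C i) = det (mat n n (\<lambda>(i, j). \<Psi> ((\<kappa>(m := Suc k)) j) (x i)))"
      unfolding C[symmetric] by (intro det_mat_cong) auto
    finally have eq: "det (mat n n (\<lambda>(i, j). add_next k \<Psi> (\<kappa> j) (x i))) =
        det (mat n n (\<lambda>(i, j). \<Psi> (\<kappa> j) (x i))) + det (mat n n (\<lambda>(i, j). \<Psi> ((\<kappa>(m := Suc k)) j) (x i)))" .
    \<comment> \<open>The shifted tuple is still increasing unless \<open>Suc k\<close> already occurs in it.\<close>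
    have "0 \<le> det (mat n n (\<lambda>(i, j). \<Psi> ((\<kappa>(m := Suc k)) j) (x i)))"
    proof (cases "\<exists>j<n. j \<noteq> m \<and> \<kappa> j = Suc k")
      case True
      then obtain j where j: "j < n" "j \<noteq> m" "\<kappa> j = Suc k" by blast
      have "det (mat n n (\<lambda>(i, j). \<Psi> ((\<kappa>(m := Suc k)) j) (x i))) = 0"
        by (rule det_identical_columns[of _ n j m]) (use j m in auto)
      then show ?thesis by simp
    next
      case False
      have "strict_mono_on {..<n} (\<kappa>(m := Suc k))"
      proof (rule strict_mono_onI)
        fix i j assume ij: "i \<in> {..<n}" "j \<in> {..<n}" "i < j"
        then have "\<kappa> i < \<kappa> j"
          using \<kappa> by (auto simp: increasing_tuple_def strict_mono_on_def)
        moreover have "j \<noteq> m \<Longrightarrow> \<kappa> j \<noteq> Suc k" using False ij by auto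
        ultimately show "(\<kappa>(m := Suc k)) i < (\<kappa>(m := Suc k)) j"
          using ij m by auto
      qed
      then show ?thesis
        by (intro less_imp_le pos) (simp add: increasing_tuple_def del: fun_upd_apply)
    qed
    with pos[OF \<kappa>] eq show ?thesis by simp
  qed
qed

section \<open>Matrices approximated by totally positive kernels\<close>

lemma totally_positive_imp_nonneg_kernel:
  "totally_positive_kernel X Y K \<Longrightarrow> totally_nonneg_kernel X Y K"
  unfolding totally_positive_kernel_def totally_nonneg_kernel_def by (meson less_imp_le)

lemma totally_positive_kernel_pos:
  assumes "totally_positive_kernel X Y K" "x \<in> X" "y \<in> Y"
  shows "K x y > 0"
proof -
  have "increasing_tuple (Suc 0) X (\<lambda>_. x)" "increasing_tuple (Suc 0) Y (\<lambda>_. y)"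
    using assms by (auto simp: increasing_tuple_def strict_mono_on_def)
  with assms(1) have "det (mat (Suc 0) (Suc 0) (\<lambda>(i, j). K x y)) > 0"
    unfolding totally_positive_kernel_def by blast
  then show ?thesis by (simp add: det_mat_1)
qed

lemma totally_nonneg_kernel_tendsto:
  assumes "F \<noteq> bot" "\<forall>\<^sub>F t in F. totally_nonneg_kernel X Y (K t)"
    and "\<And>x y. x \<in> X \<Longrightarrow> y \<in> Y \<Longrightarrow> ((\<lambda>t. K t x y) \<longlongrightarrow> L x y) F"
  shows "totally_nonneg_kernel X Y L"
  unfolding totally_nonneg_kernel_def
proof (intro allI impI)
  fix n x y assume xy: "increasing_tuple n X x" "increasing_tuple n Y y"
  have "((\<lambda>t. det (mat n n (\<lambda>(i, j). K t (x i) (y j)))) \<longlongrightarrow> det (mat n n (\<lambda>(i, j). L (x i) (y j)))) F"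
    using xy by (intro tendsto_det assms) (auto simp: increasing_tuple_def)
  moreover have "\<forall>\<^sub>F t in F. 0 \<le> det (mat n n (\<lambda>(i, j). K t (x i) (y j)))"
    using assms(2) by eventually_elim (use xy in \<open>auto simp: totally_nonneg_kernel_def\<close>)
  ultimately show "0 \<le> det (mat n n (\<lambda>(i, j). L (x i) (y j)))"
    by (rule tendsto_lowerbound) fact
qed

lemma totally_positive_kernel_fold_add_next:
  "totally_positive_kernel X UNIV (\<lambda>x k. \<Psi> k x) \<Longrightarrow>
    totally_positive_kernel X UNIV (\<lambda>x k. fold add_next ops \<Psi> k x)"
  by (induction ops arbitrary: \<Psi>) (simp_all add: totally_positive_kernel_add_next)

lemma fold_add_next_above:
  assumes "\<forall>k\<in>set ops. k < m" "m \<le> l"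
  shows "fold add_next ops \<Psi> l = \<Psi> l"
  using assms by (induction ops arbitrary: \<Psi>) (auto simp: add_next_def)

text \<open>The points \<open>x\<close> and \<open>y\<close> may have different types: the Gaussians
  live on the reals, their limit on the natural numbers.\<close>

lemma tendsto_fold_add_next:
  assumes "\<And>k. ((\<lambda>t. \<Psi> t k x) \<longlongrightarrow> L k y) F"
  shows "((\<lambda>t. fold add_next ops (\<Psi> t) k x) \<longlongrightarrow> fold add_next ops L k y) F"
  using assms
proof (induction ops arbitrary: \<Psi> L k)
  case (Cons a ops)
  have "((\<lambda>t. add_next a (\<Psi> t) k x) \<longlongrightarrow> add_next a L k y) F" for k
    by (auto simp: add_next_def intro!: tendsto_add Cons.prems)
  then show ?case
    using Cons.IH[where \<Psi> = "\<lambda>t. add_next a (\<Psi> t)" and L = "add_next a L"] by simp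
qed simp

section \<open>Gaussians and their degeneration on the grid\<close>

definition gaussian :: "real \<Rightarrow> nat \<Rightarrow> real \<Rightarrow> real" where
  "gaussian \<tau> k x = exp (- \<tau> * (x - real k)\<^sup>2)"

text \<open>Expanding the square leaves the exponential kernel up to positive row and column
  factors.\<close>

lemma totally_positive_kernel_gaussian:
  assumes "\<tau> > 0"
  shows "totally_positive_kernel X UNIV (\<lambda>x k. gaussian \<tau> k x)"
proof -
  have eq: "(\<lambda>x k. gaussian \<tau> k x) =
      (\<lambda>x k. exp (- \<tau> * x\<^sup>2) * exp (- \<tau> * (real k)\<^sup>2) * exp ((2 * \<tau>) * x * real k))"
    by (intro ext) (simp add: gaussian_def power2_eq_square algebra_simps flip: exp_add)
  show ?thesis unfolding eq using assms
    by (intro totally_positive_kernel_scale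
        totally_positive_kernel_pullback[OF totally_positive_kernel_exp, of _ "\<lambda>x. x" _ UNIV real UNIV UNIV])
      (auto simp: strict_mono_on_def)
qed

text \<open>One factor is at most 1. In the other the square \<open>(x - real k)\<^sup>2\<close> is
  bounded below by a tangent line, linear in \<open>k\<close>, which gives a geometric
  majorant.\<close>

lemma summable_gaussian_product:
  assumes "\<tau> > 0"
  shows "summable (\<lambda>k. gaussian \<tau> k x * gaussian \<tau> k y)"
proof (rule summable_comparison_test)
  show "summable (\<lambda>k. exp (\<tau> * (2 * x + 1)) * exp (- 2 * \<tau>) ^ k)"
    using assms by (intro summable_mult summable_geometric) simp
  have "gaussian \<tau> k x * gaussian \<tau> k y \<le> exp (\<tau> * (2 * x + 1)) * exp (- 2 * \<tau>) ^ k" for k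
  proof -
    have "gaussian \<tau> k y \<le> 1" using assms by (simp add: gaussian_def)
    moreover have "2 * (real k - x) - 1 \<le> (x - real k)\<^sup>2"
      using zero_le_power2[of "x - real k + 1"] by (simp add: power2_eq_square algebra_simps)
    then have "\<tau> * (2 * (real k - x) - 1) \<le> \<tau> * (x - real k)\<^sup>2"
      using assms by (intro mult_left_mono) auto
    then have "gaussian \<tau> k x \<le> exp (\<tau> * (2 * x + 1)) * exp (- 2 * \<tau>) ^ k"
      by (simp add: gaussian_def algebra_simps flip: exp_of_nat_mult exp_add)
    moreover have "0 \<le> gaussian \<tau> k x" by (simp add: gaussian_def)
    ultimately show ?thesis by (meson mult_left_le order_trans)
  qed
  moreover have "0 \<le> gaussian \<tau> k x * gaussian \<tau> k y" for k by (simp add: gaussian_def)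
  ultimately show "\<exists>N. \<forall>k\<ge>N. norm (gaussian \<tau> k x * gaussian \<tau> k y) \<le>
      exp (\<tau> * (2 * x + 1)) * exp (- 2 * \<tau>) ^ k"
    by auto
qed

lemma tendsto_gaussian_nat:
  "((\<lambda>\<tau>. gaussian \<tau> k (real i)) \<longlongrightarrow> of_bool (i = k)) at_top"
proof (cases "i = k")
  case True
  then show ?thesis by (simp add: gaussian_def)
next
  case False
  then have "filterlim (\<lambda>\<tau>. - (real i - real k)\<^sup>2 * \<tau>) at_bot at_top"
    by (intro filterlim_tendsto_neg_mult_at_bot[OF tendsto_const _ filterlim_ident]) simp
  then have "((\<lambda>\<tau>. exp (- (real i - real k)\<^sup>2 * \<tau>)) \<longlongrightarrow> 0) at_top"
    by (rule filterlim_compose[OF exp_at_bot])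
  with False show ?thesis by (simp add: gaussian_def mult.commute)
qed

text \<open>The Gram form \<open>B * D * B\<^sup>T\<close> with \<open>D\<close> the diagonal matrix
  of the weights and \<open>B\<close> the result of the column operations \<open>ops\<close>,
  performed from left to right. Its form makes it symmetric.\<close>

definition fold_kernel :: "nat list \<Rightarrow> nat \<Rightarrow> (nat \<Rightarrow> real) \<Rightarrow> (nat \<Rightarrow> 'a \<Rightarrow> real) \<Rightarrow> 'a \<Rightarrow> 'a \<Rightarrow> real" where
  "fold_kernel ops m w \<Psi> x y = (\<Sum>k<m. w k * fold add_next ops \<Psi> k x * fold add_next ops \<Psi> k y)"

text \<open>Adding \<open>\<epsilon>\<close> to all weights, also those beyond \<open>m\<close>, gives a kernel of infinite rank, which can be
  totally positive on an infinite set. After \<open>\<epsilon> \<rightarrow> 0\<close>, the Gaussians degenerate to the identity matrix on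
  the grid as \<open>\<tau> \<rightarrow> \<infinity>\<close>.\<close>

theorem totally_nonneg_kernel_fold_kernel:
  fixes G :: "real \<Rightarrow> real"
  assumes G: "continuous_on {0..} G"
    and preserves: "\<And>K. symmetric_kernel (UNIV :: real set) K \<Longrightarrow> totally_positive_kernel UNIV UNIV K \<Longrightarrow>
      totally_nonneg_kernel (UNIV :: nat set) UNIV (\<lambda>i j. G (K (real i) (real j)))"
    and ops: "\<forall>k\<in>set ops. k < m" and w: "\<And>k. k < m \<Longrightarrow> w k \<ge> 0"
  shows "totally_nonneg_kernel UNIV UNIV (\<lambda>i j. G (fold_kernel ops m w (\<lambda>k i. of_bool (i = k)) i j))"
proof (rule totally_nonneg_kernel_tendsto[where F = at_top])
  let ?K = "\<lambda>\<tau>. fold_kernel ops m w (gaussian \<tau>)"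
  \<comment> \<open>Continuity of \<open>G\<close> is known only on \<open>{0..}\<close>, so the
    argument must be eventually non-negative, and then so is its limit.\<close>
  have G_tendsto: "((\<lambda>t. G (f t)) \<longlongrightarrow> G a) F"
    if "(f \<longlongrightarrow> a) F" "\<forall>\<^sub>F t in F. f t \<ge> 0" "F \<noteq> bot" for f a and F :: "real filter"
    using continuous_on_tendsto_compose[OF G that(1)] tendsto_lowerbound[OF that] that(2) by simp
  have \<Psi>_nonneg: "fold add_next ops (gaussian \<tau>) k x \<ge> 0" if "\<tau> > 0" for \<tau> k x
    using totally_positive_kernel_pos[OF totally_positive_kernel_fold_add_next[OF
          totally_positive_kernel_gaussian[OF that, of UNIV]], of x k ops] by simp
  then have K_nonneg: "?K \<tau> x y \<ge> 0" if "\<tau> > 0" for \<tau> x y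
    using w that by (auto simp: fold_kernel_def intro!: sum_nonneg mult_nonneg_nonneg)
  show "((\<lambda>\<tau>. G (?K \<tau> (real i) (real j))) \<longlongrightarrow>
      G (fold_kernel ops m w (\<lambda>k i. of_bool (i = k)) i j)) at_top" for i j
    by (rule G_tendsto, unfold fold_kernel_def[of ops m w _ "real i" "real j"] fold_kernel_def[of ops m w _ i j])
      (auto intro!: tendsto_sum tendsto_mult tendsto_const tendsto_fold_add_next tendsto_gaussian_nat
        sum_nonneg mult_nonneg_nonneg w \<Psi>_nonneg eventually_mono[OF eventually_gt_at_top[of 0]])
  show "\<forall>\<^sub>F \<tau> in at_top. totally_nonneg_kernel UNIV UNIV (\<lambda>i j. G (?K \<tau> (real i) (real j)))"
  proof (rule eventually_mono[OF eventually_gt_at_top[of 0]])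
    fix \<tau> :: real assume \<tau>: "\<tau> > 0"
    let ?\<Psi> = "fold add_next ops (gaussian \<tau>)"
    let ?w = "\<lambda>k. if k < m then w k else 0"
    let ?L = "\<lambda>\<epsilon> x y. \<Sum>k. (?w k + \<epsilon>) * ?\<Psi> k x * ?\<Psi> k y"
    \<comment> \<open>From index \<open>m\<close> on, the column operations have changed nothing, so
      the tail is that of the Gaussian series.\<close>
    have "summable (\<lambda>k. ?\<Psi> k x * ?\<Psi> k y)" for x y
      using summable_gaussian_product[OF \<tau>, of x y]
      by (subst summable_cong[of _ "\<lambda>k. gaussian \<tau> k x * gaussian \<tau> k y"])
        (auto intro!: eventually_sequentiallyI[of m] simp: fold_add_next_above[OF ops])
    then have summable: "summable (\<lambda>k. \<epsilon> * (?\<Psi> k x * ?\<Psi> k y))" for \<epsilon> x y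
      by (rule summable_mult)
    have sums: "(\<lambda>k. (?w k + \<epsilon>) * ?\<Psi> k x * ?\<Psi> k y) sums
        (?K \<tau> x y + \<epsilon> * (\<Sum>k. ?\<Psi> k x * ?\<Psi> k y))" for \<epsilon> x y
    proof -
      have "(\<lambda>k. ?w k * ?\<Psi> k x * ?\<Psi> k y) sums (\<Sum>k<m. ?w k * ?\<Psi> k x * ?\<Psi> k y)"
        by (rule sums_finite) auto
      moreover have "(\<Sum>k<m. ?w k * ?\<Psi> k x * ?\<Psi> k y) = ?K \<tau> x y"
        by (simp add: fold_kernel_def)
      moreover have "(\<lambda>k. \<epsilon> * (?\<Psi> k x * ?\<Psi> k y)) sums (\<epsilon> * (\<Sum>k. ?\<Psi> k x * ?\<Psi> k y))"
        using summable[of 1 x y] by (intro sums_mult summable_sums) simp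
      ultimately show ?thesis
        using sums_add[of "\<lambda>k. ?w k * ?\<Psi> k x * ?\<Psi> k y" _ "\<lambda>k. \<epsilon> * (?\<Psi> k x * ?\<Psi> k y)"]
        by (simp add: algebra_simps)
    qed
    have L_eq: "?L \<epsilon> x y = ?K \<tau> x y + \<epsilon> * (\<Sum>k. ?\<Psi> k x * ?\<Psi> k y)" for \<epsilon> x y
      using sums[THEN sums_unique] by simp
    have TP: "totally_positive_kernel UNIV UNIV (?L \<epsilon>)" if "\<epsilon> > 0" for \<epsilon>
      using that w sums
      by (intro totally_positive_kernel_suminf totally_positive_kernel_fold_add_next
          totally_positive_kernel_gaussian \<tau>) (auto simp: sums_iff add_nonneg_pos)
    show "totally_nonneg_kernel UNIV UNIV (\<lambda>i j. G (?K \<tau> (real i) (real j)))"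
    proof (rule totally_nonneg_kernel_tendsto[where F = "at_right 0"])
      show "\<forall>\<^sub>F \<epsilon> in at_right 0. totally_nonneg_kernel UNIV UNIV (\<lambda>i j. G (?L \<epsilon> (real i) (real j)))"
        by (rule eventually_mono[OF eventually_at_right_less])
          (intro preserves TP, auto simp: symmetric_kernel_def mult_ac)
      show "((\<lambda>\<epsilon>. G (?L \<epsilon> (real i) (real j))) \<longlongrightarrow> G (?K \<tau> (real i) (real j))) (at_right 0)" for i j
      proof (rule G_tendsto)
        show "\<forall>\<^sub>F \<epsilon> in at_right 0. 0 \<le> ?L \<epsilon> (real i) (real j)"
          by (rule eventually_mono[OF eventually_at_right_less])
            (use totally_positive_kernel_pos[OF TP] in \<open>simp add: less_imp_le\<close>)
        show "((\<lambda>\<epsilon>. ?L \<epsilon> (real i) (real j)) \<longlongrightarrow> ?K \<tau> (real i) (real j)) (at_right 0)"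
          unfolding L_eq by (auto intro!: tendsto_eq_intros)
      qed simp
    qed simp
  qed
qed simp

section \<open>Power functions\<close>

text \<open>In logarithmic coordinates the hypothesis compares sums of two values of
  \<open>h\<close> whenever the sums of the arguments compare strictly. Hence \<open>h\<close> is
  monotone and nearly additive, and comparison with integer multiples shows that it is
  linear.\<close>

lemma power_function_if_supermodular:
  fixes F :: "real \<Rightarrow> real"
  assumes pos: "\<And>x. x > 0 \<Longrightarrow> F x > 0"
    and super: "\<And>a b c d. \<lbrakk>a > 0; b > 0; c > 0; d > 0; b * c < a * d\<rbrakk> \<Longrightarrow> F b * F c \<le> F a * F d"
  shows "\<exists>c>0. \<exists>\<alpha>\<ge>0. \<forall>x>0. F x = c * x powr \<alpha>"
proof -
  define h where "h x = ln (F (exp x)) - ln (F 1)" for x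
  have h0: "h 0 = 0" by (simp add: h_def)
  have h4: "h q + h r \<le> h p + h s" if "q + r < p + s" for p q r s
  proof -
    have "F (exp q) * F (exp r) \<le> F (exp p) * F (exp s)"
      using that by (intro super) (auto simp flip: exp_add)
    then have "ln (F (exp q) * F (exp r)) \<le> ln (F (exp p) * F (exp s))"
      by (simp add: pos)
    then show ?thesis by (simp add: ln_mult_pos pos h_def)
  qed
  have mono: "h q \<le> h p" if "q < p" for p q using h4[of q q p p] that by simp
  have upper: "real n * h x \<le> h z" if "real n * x < z" for n x z
    using that
  proof (induction n arbitrary: z)
    case 0
    then show ?case using mono[of 0 z] h0 by simp
  next
    case (Suc n)
    \<comment> \<open>The midpoint of \<open>real n * x\<close> and \<open>z - x\<close>, so that
      both inequalities stay strict.\<close>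
    define v where "v = (real n * x + z - x) / 2"
    have "real n * x < v" "v + x < z" using Suc.prems by (auto simp: v_def field_simps)
    then have "real n * h x \<le> h v" "h v + h x \<le> h z" using Suc.IH h4[of v x z 0] h0 by auto
    then show ?case by (simp add: algebra_simps)
  qed
  have lower: "h z \<le> real n * h x" if "z < real n * x" for n x z
    using that
  proof (induction n arbitrary: z)
    case 0
    then show ?case using mono[of z 0] h0 by simp
  next
    case (Suc n)
    define v where "v = (real n * x + z - x) / 2"
    have "v < real n * x" "z < v + x" using Suc.prems by (auto simp: v_def field_simps)
    then have "h v \<le> real n * h x" "h z \<le> h v + h x" using Suc.IH h4[of z 0 v x] h0 by auto
    then show ?case by (simp add: algebra_simps)
  qed
  define \<alpha> where "\<alpha> = h 1"
  have \<alpha>: "\<alpha> \<ge> 0" using mono[of 0 1] h0 by (simp add: \<alpha>_def)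
  have h_pos: "h x = \<alpha> * x" if "x > 0" for x
  proof (rule antisym)
    \<comment> \<open>A bound uniform in \<open>m\<close> gives
      \<open>h x \<le> \<alpha> * x\<close> by the Archimedean property. The integer
      \<open>n\<close> exceeds \<open>real m * x\<close> by at most 2, and \<open>h\<close> at a
      point between them links \<open>m\<close> copies of \<open>h x\<close> with \<open>n\<close>
      copies of \<open>h 1\<close>.\<close>
    have "real m * (h x - \<alpha> * x) \<le> 2 * \<alpha>" for m
    proof -
      define n where "n = nat \<lceil>real m * x\<rceil> + 1"
      have "real m * x < real n" "real n \<le> real m * x + 2"
        unfolding n_def using that by (auto simp: nat_add_distrib) linarith+
      then have "real m * h x \<le> real n * \<alpha>"
        using upper[of m x "(real m * x + real n) / 2"] lower[of "(real m * x + real n) / 2" n 1]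
        by (simp add: \<alpha>_def field_simps)
      also have "\<dots> \<le> (real m * x + 2) * \<alpha>"
        using \<open>real n \<le> real m * x + 2\<close> \<alpha> by (intro mult_right_mono) auto
      finally show ?thesis by (simp add: algebra_simps)
    qed
    then show "h x \<le> \<alpha> * x"
      using reals_Archimedean3[of "h x - \<alpha> * x"] by (metis diff_gt_0_iff_gt linorder_not_le)
    have "real m * (\<alpha> * x - h x) \<le> \<alpha>" for m
    proof (cases "m = 0")
      case True
      then show ?thesis using \<alpha> by simp
    next
      case False
      \<comment> \<open>The largest integer strictly below \<open>real m * x\<close>; it is
        non-negative because \<open>m\<close> is not 0.\<close>
      define n where "n = nat (\<lceil>real m * x\<rceil> - 1)"
      have mx: "real m * x > 0" using False that by simp
      have n: "real n < real m * x" "real m * x - 1 \<le> real n"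
        unfolding n_def using mx by linarith+
      then have "real n * \<alpha> \<le> real m * h x"
        using lower[of "(real m * x + real n) / 2" m x] upper[of n 1 "(real m * x + real n) / 2"]
        by (simp add: \<alpha>_def field_simps)
      moreover have "(real m * x - 1) * \<alpha> \<le> real n * \<alpha>"
        using n \<alpha> by (intro mult_right_mono) auto
      ultimately show ?thesis by (simp add: algebra_simps)
    qed
    then show "\<alpha> * x \<le> h x"
      using reals_Archimedean3[of "\<alpha> * x - h x"] by (metis diff_gt_0_iff_gt linorder_not_le)
  qed
  \<comment> \<open>A negative \<open>x\<close> is paired with a positive argument, where
    \<open>h\<close> is already known; the strictness that \<open>h4\<close> requires costs
    \<delta>.\<close>
  have h_neg: "h x = \<alpha> * x" if "x < 0" for x
  proof (rule antisym)
    \<comment> \<open>The denominator is \<open>\<alpha> + 1\<close> because \<alpha> may be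
      0.\<close>
    have eps: "\<exists>\<delta>>0. \<alpha> * \<delta> \<le> e" if "e > 0" for e
      using \<alpha> that by (intro exI[of _ "e / (\<alpha> + 1)"]) (auto simp: field_simps)
    show "h x \<le> \<alpha> * x"
    proof (rule field_le_epsilon)
      fix e :: real assume "e > 0"
      then obtain \<delta> where \<delta>: "\<delta> > 0" "\<alpha> * \<delta> \<le> e" using eps by blast
      then have "h x + h (- x) \<le> h \<delta> + h 0" by (intro h4) simp
      with \<delta> that show "h x \<le> \<alpha> * x + e" by (simp add: h_pos h0)
    qed
    show "\<alpha> * x \<le> h x"
    proof (rule field_le_epsilon)
      fix e :: real assume "e > 0"
      then obtain \<delta> where \<delta>: "\<delta> > 0" "\<alpha> * \<delta> \<le> e" using eps by blast
      then have "h 1 + h 0 \<le> h x + h (1 - x + \<delta>)" by (intro h4) simp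
      with \<delta> that have "\<alpha> \<le> h x + \<alpha> * (1 - x + \<delta>)" by (simp add: h_pos[of 1] h_pos[of "1 - x + \<delta>"] h0)
      with \<delta> show "\<alpha> * x \<le> h x + e" by (simp add: algebra_simps)
    qed
  qed
  have h: "h x = \<alpha> * x" for x using h_pos[of x] h_neg[of x] h0 by (cases x "0 :: real" rule: linorder_cases) auto
  have "F x = F 1 * x powr \<alpha>" if "x > 0" for x
  proof -
    have "ln (F x) = ln (F 1) + \<alpha> * ln x" using h[of "ln x"] that by (simp add: h_def)
    then have "F x = exp (ln (F 1) + \<alpha> * ln x)" using pos[OF that] by (metis exp_ln)
    also have "\<dots> = F 1 * x powr \<alpha>" using that pos[of 1] by (simp add: exp_add powr_def)
    finally show ?thesis .
  qed
  then have "\<forall>x>0. F x = F 1 * x powr \<alpha>" by blast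
  moreover have "F 1 > 0" by (rule pos) simp
  ultimately show ?thesis using \<alpha> by blast
qed

lemma totally_nonneg_kernel_2:
  assumes "totally_nonneg_kernel X Y K" "x1 \<in> X" "x2 \<in> X" "x1 < x2" "y1 \<in> Y" "y2 \<in> Y" "y1 < y2"
  shows "K x1 y2 * K x2 y1 \<le> K x1 y1 * K x2 y2"
proof -
  let ?x = "\<lambda>i::nat. if i = 0 then x1 else x2" and ?y = "\<lambda>i::nat. if i = 0 then y1 else y2"
  have "increasing_tuple 2 X ?x" "increasing_tuple 2 Y ?y"
    using assms by (auto simp: increasing_tuple_def strict_mono_on_def)
  with assms(1) have "det (mat 2 2 (\<lambda>(i, j). K (?x i) (?y j))) \<ge> 0"
    unfolding totally_nonneg_kernel_def by blast
  then show ?thesis by (simp add: det_mat_2)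
qed

lemma totally_positive_kernel_2:
  assumes "totally_positive_kernel X Y K" "x1 \<in> X" "x2 \<in> X" "x1 < x2" "y1 \<in> Y" "y2 \<in> Y" "y1 < y2"
  shows "K x1 y2 * K x2 y1 < K x1 y1 * K x2 y2"
proof -
  let ?x = "\<lambda>i::nat. if i = 0 then x1 else x2" and ?y = "\<lambda>i::nat. if i = 0 then y1 else y2"
  have "increasing_tuple 2 X ?x" "increasing_tuple 2 Y ?y"
    using assms by (auto simp: increasing_tuple_def strict_mono_on_def)
  with assms(1) have "det (mat 2 2 (\<lambda>(i, j). K (?x i) (?y j))) > 0"
    unfolding totally_positive_kernel_def by blast
  then show ?thesis by (simp add: det_mat_2)
qed

text \<open>Rows \<open>1, 2\<close> and columns \<open>3, 4\<close> do not meet the diagonal, so symmetry does not constrain the block.\<close>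

lemma symmetric_totally_positive_kernel_block:
  fixes a b c d :: real
  assumes "a > 0" "b > 0" "c > 0" "d > 0" "b * c < a * d"
  obtains K where "symmetric_kernel (UNIV :: real set) K" "totally_positive_kernel UNIV UNIV K"
    "K 1 3 = a" "K 1 4 = b" "K 2 3 = c" "K 2 4 = d"
proof
  \<comment> \<open>The ratio \<open>a * d / (b * c)\<close> is invariant under scaling of rows and
    columns, and for the exponential kernel it is \<open>exp t\<close>, as
    \<open>3 + 8 - 4 - 6 = 1\<close>. With \<open>r 1 = 1\<close>, the values of \<open>r\<close> at
    3, 4 and 2 then solve for \<open>a\<close>, \<open>b\<close> and \<open>c\<close>.\<close>
  define t where "t = ln (a * d / (b * c))"
  have t: "t > 0" "exp t = a * d / (b * c)" using assms by (auto simp: t_def)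
  define r where "r x = (if x = 2 then c / (a * exp (3 * t)) else if x = 3 then a / exp (3 * t)
    else if x = 4 then b / exp (4 * t) else 1)" for x :: real
  let ?K = "\<lambda>x y. r x * r y * exp (t * x * y)"
  have r: "r x > 0" for x using assms by (simp add: r_def)
  show "symmetric_kernel UNIV ?K" by (simp add: symmetric_kernel_def mult_ac)
  show "totally_positive_kernel UNIV UNIV ?K"
    by (intro totally_positive_kernel_scale totally_positive_kernel_exp t r)
  show "?K 1 3 = a" "?K 1 4 = b" "?K 2 3 = c"
    using assms by (simp_all add: r_def mult.commute[of t] flip: exp_add)
  have "exp (t * 8) = exp (3 * t) * exp (4 * t) * exp t" by (simp flip: exp_add)
  then show "?K 2 4 = d" using assms by (simp add: r_def t field_simps)
qed

text \<open>Taylor's formula with Lagrange remainder; the intermediate point, chosen as a function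
  of \<open>s\<close>, is squeezed to 0.\<close>

lemma powr_second_order:
  fixes \<alpha> c :: real
  assumes "c > 0"
  shows "((\<lambda>s. ((1 + c * s) powr \<alpha> - 1 - \<alpha> * c * s) / s\<^sup>2) \<longlongrightarrow> \<alpha> * (\<alpha> - 1) / 2 * c\<^sup>2) (at_right 0)"
proof -
  let ?d = "\<lambda>(m :: nat) s. if m = 0 then (1 + c * s) powr \<alpha> else if m = 1 then \<alpha> * c * (1 + c * s) powr (\<alpha> - 1)
    else \<alpha> * (\<alpha> - 1) * c\<^sup>2 * (1 + c * s) powr (\<alpha> - 2)"
  have "\<exists>t>0. t < s \<and> ((1 + c * s) powr \<alpha> - 1 - \<alpha> * c * s) / s\<^sup>2 =
      \<alpha> * (\<alpha> - 1) / 2 * c\<^sup>2 * (1 + c * t) powr (\<alpha> - 2)" if "s > 0" for s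
  proof -
    have "\<exists>t>0. t < s \<and> (1 + c * s) powr \<alpha> = (\<Sum>m<2. ?d m 0 / fact m * s ^ m) + ?d 2 t / fact 2 * s ^ 2"
    proof (rule Maclaurin[where diff = ?d])
      show "\<forall>m t. m < 2 \<and> 0 \<le> t \<and> t \<le> s \<longrightarrow> (?d m has_real_derivative ?d (Suc m) t) (at t)"
      proof (intro allI impI)
        fix m :: nat and t assume m: "m < 2 \<and> 0 \<le> t \<and> t \<le> s"
        then have "1 + c * t > 0" using assms by (simp add: add_pos_nonneg)
        then have D: "((\<lambda>s. (1 + c * s) powr \<beta>) has_real_derivative \<beta> * (1 + c * t) powr (\<beta> - 1) * c) (at t)" for \<beta>
          by (intro DERIV_chain2[OF has_real_derivative_powr]) (auto intro!: derivative_eq_intros)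
        consider "m = 0" | "m = 1" using m by linarith
        then show "(?d m has_real_derivative ?d (Suc m) t) (at t)"
        proof cases
          case 1
          then show ?thesis using D[of \<alpha>] by (simp add: mult_ac)
        next
          case 2
          then show ?thesis using DERIV_cmult[OF D[of "\<alpha> - 1"], of "\<alpha> * c"]
            by (simp add: power2_eq_square mult_ac)
        qed
      qed
    qed (use that in auto)
    then show ?thesis using that
      by (auto simp: lessThan_nat_numeral lessThan_Suc numeral_2_eq_2 field_simps)
  qed
  then obtain t where t: "\<And>s. s > 0 \<Longrightarrow> t s > 0 \<and> t s < s \<and> ((1 + c * s) powr \<alpha> - 1 - \<alpha> * c * s) / s\<^sup>2 =
      \<alpha> * (\<alpha> - 1) / 2 * c\<^sup>2 * (1 + c * t s) powr (\<alpha> - 2)"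
    by metis
  have "(t \<longlongrightarrow> 0) (at_right 0)"
    by (rule tendsto_sandwich[of "\<lambda>_. 0" _ _ "\<lambda>s. s"])
      (use t in \<open>auto intro!: eventually_mono[OF eventually_at_right_less] less_imp_le\<close>)
  then have "((\<lambda>s. \<alpha> * (\<alpha> - 1) / 2 * c\<^sup>2 * (1 + c * t s) powr (\<alpha> - 2)) \<longlongrightarrow>
      \<alpha> * (\<alpha> - 1) / 2 * c\<^sup>2 * (1 + c * 0) powr (\<alpha> - 2)) (at_right 0)"
    by (intro tendsto_intros) auto
  then have "((\<lambda>s. \<alpha> * (\<alpha> - 1) / 2 * c\<^sup>2 * (1 + c * t s) powr (\<alpha> - 2)) \<longlongrightarrow>
      \<alpha> * (\<alpha> - 1) / 2 * c\<^sup>2) (at_right 0)" by simp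
  then show ?thesis
    by (rule Lim_transform_eventually) (use t in \<open>auto intro!: eventually_mono[OF eventually_at_right_less]\<close>)
qed


section \<open>The two test matrices and the exponent\<close>

lemma lessThan_small:
  "{..<2::nat} = {0, 1}" "{..<3::nat} = {0, 1, 2}" "{..<5::nat} = {0, 1, 2, 3, 4}"
  by auto

text \<open>With unit vectors \<open>e k\<close>, the matrix is the sum of the squares
  \<open>u * u\<^sup>T\<close> for \<open>u = e 0 + e 1\<close> and \<open>u = e 1 + e 2\<close>.
  Operation 0 comes first, so that it still adds the bare \<open>e 1\<close>.\<close>

lemma tridiagonal_fold_kernel:
  fixes i j :: nat
  assumes "i < 3" "j < 3"
  shows "fold_kernel [0, 1] 3 (\<lambda>k. if k < 2 then 1 else 0) (\<lambda>k i. of_bool (i = k)) i j =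
    (if i = j then if i = 1 then 2 else 1 else if i + j = 2 then 0 else 1)"
proof -
  have "i \<in> {0, 1, 2}" "j \<in> {0, 1, 2}" using assms by auto
  then show ?thesis
    by (elim insertE emptyE) (simp_all add: fold_kernel_def lessThan_small add_next_def)
qed

text \<open>Two passes of summation from the right: \<open>3, 2, 1, 0\<close> turns unit vectors
  into indicators of \<open>i \<ge> k\<close>, and \<open>3, 2, 1\<close> sums these once more.
  Indices 0, 1 and 3 then carry \<open>1\<close>, \<open>i\<close> and the truncated
  \<open>i - 2\<close>, the truncation being subtraction on \<open>nat\<close>.\<close>

lemma spline_fold_kernel:
  fixes i j :: nat
  assumes "i < 5" "j < 5"
  shows "fold_kernel [3, 2, 1, 0, 3, 2, 1] 5 (\<lambda>k. if k = 0 then 1 else if k = 1 \<or> k = 3 then s else 0)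
      (\<lambda>k i. of_bool (i = k)) i j = 1 + s * (real i * real j + real (i - 2) * real (j - 2))"
proof -
  have "i \<in> {0, 1, 2, 3, 4}" "j \<in> {0, 1, 2, 3, 4}" using assms by auto
  then show ?thesis
    by (elim insertE emptyE) (simp_all add: fold_kernel_def lessThan_small add_next_def)
qed


lemma exponent_eq_1_if_preserves:
  fixes c \<alpha> :: real
  assumes "c > 0" "\<alpha> > 0"
    and preserves: "\<And>K. symmetric_kernel (UNIV :: real set) K \<Longrightarrow> totally_positive_kernel UNIV UNIV K \<Longrightarrow>
      totally_nonneg_kernel (UNIV :: nat set) UNIV (\<lambda>i j. c * K (real i) (real j) powr \<alpha>)"
  shows "\<alpha> = 1"
proof -
  \<comment> \<open>Since \<open>0 powr \<alpha> = 0\<close>, continuity at the endpoint rests on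
    \<open>\<alpha> > 0\<close>.\<close>
  have cont: "continuous_on {0..} (\<lambda>x. c * x powr \<alpha>)"
    using \<open>\<alpha> > 0\<close> by (intro continuous_intros continuous_on_powr') auto
  note fold_nonneg = totally_nonneg_kernel_fold_kernel[OF cont preserves, unfolded totally_nonneg_kernel_def, rule_format]
  have tuple_id: "increasing_tuple n UNIV (\<lambda>i::nat. i)" for n
    by (simp add: increasing_tuple_def strict_mono_on_def)
  have "0 \<le> det (mat 3 3 (\<lambda>(i, j). c * fold_kernel [0, 1] 3 (\<lambda>k. if k < 2 then 1 else 0)
      (\<lambda>k i. of_bool (i = k)) i j powr \<alpha>))"
    by (rule fold_nonneg[OF _ _ _ _ tuple_id tuple_id]) auto
  also have "\<dots> = det (mat 3 3 (\<lambda>(i, j). c *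
      (if i = j then if i = 1 then 2 else 1 else if i + j = 2 then 0 else 1) powr \<alpha>))"
    by (rule det_mat_cong) (simp only: tridiagonal_fold_kernel)
  also have "\<dots> = c ^ 3 * (2 powr \<alpha> - 2)"
    using \<open>\<alpha> > 0\<close> by (simp add: det_mat_3 power3_eq_cube algebra_simps)
  finally have "0 \<le> c ^ 3 * (2 powr \<alpha> - 2)" .
  then have "2 \<le> 2 powr \<alpha>" using \<open>c > 0\<close> by (simp add: zero_le_mult_iff)
  then have "\<alpha> \<ge> 1" using powr_less_mono[of \<alpha> 1 2] by fastforce
  moreover have "\<alpha> \<le> 1"
  proof (rule ccontr)
    assume "\<not> \<alpha> \<le> 1"
    \<comment> \<open>Columns \<open>0, 2, 3, 4\<close>. The coefficients of \<open>s\<close> in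
      rows 1, 2, 3 are then \<open>0, 2, 3, 4\<close>, \<open>0, 4, 6, 8\<close> and
      \<open>0, 6, 10, 14\<close>; the second is twice the first, so the leading term of the minor
      cancels.\<close>
    let ?y = "\<lambda>j::nat. if j = 0 then 0 else Suc j"
    define g where "g s a = (1 + a * s) powr \<alpha>" for s a :: real
    \<comment> \<open>Taylor quotients with finite limits as \<open>s\<close> tends to 0:
      \<open>e\<close> is the second-order one and \<open>p\<close> the first-order one, so that
      \<open>g s a = 1 + s * p s a\<close>.\<close>
    define e where "e s a = (g s a - 1 - \<alpha> * a * s) / s\<^sup>2" for s a
    define p where "p s a = \<alpha> * a + s * e s a" for s a
    \<comment> \<open>Up to order \<open>s\<close>, the second row of the reduced minor is twice the first one; \<open>q\<close> measures the difference.\<close>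
    define q where "q s a = e s (2 * a) - 2 * e s a" for s a
    have g_eq: "g s a = 1 + s * p s a" if "s > 0" for s a
      using that by (simp add: p_def e_def field_simps power2_eq_square)
    let ?det = "\<lambda>a1 a2 a3 b1 b2 b3 c1 c2 c3 :: real. a1 * (b2 * c3 - b3 * c2) - a2 * (b1 * c3 - b3 * c1) + a3 * (b1 * c2 - b2 * c1)"
    let ?Q = "\<lambda>s. ?det (p s 2) (p s 3) (p s 4) (q s 2) (q s 3) (q s 4) (p s 6) (p s 10) (p s 14)"
    have Q_nonneg: "?Q s \<ge> 0" if s: "s > 0" for s
    proof -
      let ?w = "\<lambda>k::nat. if k = 0 then 1 else if k = 1 \<or> k = 3 then s else 0"
      let ?A = "fold_kernel [3, 2, 1, 0, 3, 2, 1] 5 ?w (\<lambda>k i. of_bool (i = k))"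
      have "0 \<le> det (mat (Suc 3) (Suc 3) (\<lambda>(i, j). c * ?A i (?y j) powr \<alpha>))"
        by (rule fold_nonneg[OF _ _ _ _ tuple_id]) (use s in \<open>auto simp: increasing_tuple_def strict_mono_on_def\<close>)
      also have "\<dots> = det (mat (Suc 3) (Suc 3) (\<lambda>(i, j). c * 1 * (?A i (?y j) powr \<alpha>)))" by simp
      also have "\<dots> = c ^ 4 * det (mat (Suc 3) (Suc 3) (\<lambda>(i, j). ?A i (?y j) powr \<alpha>))"
        by (subst det_scale_rows_columns) simp
      also have "det (mat (Suc 3) (Suc 3) (\<lambda>(i, j). ?A i (?y j) powr \<alpha>)) =
          det (mat (Suc 3) (Suc 3) (\<lambda>(i, j). if i = 0 then 1
            else g s (real i * real (?y j) + real (i - 2) * real (?y j - 2))))"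
      proof (rule det_mat_cong)
        fix i j :: nat assume "i < Suc 3" "j < Suc 3"
        then have "?A i (?y j) = 1 + s * (real i * real (?y j) + real (i - 2) * real (?y j - 2))"
          by (intro spline_fold_kernel) auto
        then show "?A i (?y j) powr \<alpha> = (if i = 0 then 1
            else g s (real i * real (?y j) + real (i - 2) * real (?y j - 2)))"
          by (simp only: g_def mult.commute[of s]) simp
      qed
      also have "\<dots> = ?det (g s 2 - 1) (g s 3 - g s 2) (g s 4 - g s 3) (g s 4 - 1) (g s 6 - g s 4)
          (g s 8 - g s 6) (g s 6 - 1) (g s 10 - g s 6) (g s 14 - g s 10)"
        unfolding det_first_row_one by (simp add: det_mat_3 g_def)
      \<comment> \<open>Adding columns undoes the successive differences. Each of the three rows
        yields a factor \<open>s\<close>, and subtracting twice the first row from the second yields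
        the fourth.\<close>
      also have "\<dots> = s ^ 4 * ?Q s"
      proof -
        have p_double: "p s (2 * a) = 2 * p s a + s * q s a" for a
          by (simp add: p_def q_def algebra_simps)
        have sq: "s * q s 2 = p s 4 - 2 * p s 2" "s * q s 3 = p s 6 - 2 * p s 3" "s * q s 4 = p s 8 - 2 * p s 4"
          using p_double[of 2] p_double[of 3] p_double[of 4] by simp_all
        have "s ^ 4 * ?Q s = s ^ 3 * ?det (p s 2) (p s 3) (p s 4) (s * q s 2) (s * q s 3) (s * q s 4)
            (p s 6) (p s 10) (p s 14)"
          by (simp add: eval_nat_numeral algebra_simps)
        then show ?thesis unfolding g_eq[OF s] sq by (simp add: power3_eq_cube algebra_simps)
      qed
      finally show ?thesis using s \<open>c > 0\<close> by (simp add: zero_le_mult_iff)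
    qed
    let ?b = "\<alpha> * (\<alpha> - 1) / 2"
    have e: "((\<lambda>s. e s a) \<longlongrightarrow> ?b * a\<^sup>2) (at_right 0)" if "a > 0" for a
      unfolding e_def g_def by (rule powr_second_order[OF that])
    have p: "((\<lambda>s. p s a) \<longlongrightarrow> \<alpha> * a) (at_right 0)" if "a > 0" for a
      unfolding p_def using e[OF that] by (auto intro!: tendsto_eq_intros)
    have q: "((\<lambda>s. q s a) \<longlongrightarrow> ?b * (2 * a\<^sup>2)) (at_right 0)" if "a > 0" for a
      unfolding q_def using e[of a] e[of "2 * a"] that
      by (auto intro!: tendsto_eq_intros simp: power2_eq_square field_simps)
    have "(?Q \<longlongrightarrow> ?det (\<alpha> * 2) (\<alpha> * 3) (\<alpha> * 4) (?b * (2 * 2\<^sup>2)) (?b * (2 * 3\<^sup>2)) (?b * (2 * 4\<^sup>2))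
        (\<alpha> * 6) (\<alpha> * 10) (\<alpha> * 14)) (at_right 0)"
      by (intro tendsto_intros p q) auto
    \<comment> \<open>This determinant equals
      \<open>- 4 * \<alpha> ^ 3 * (\<alpha> - 1)\<close>.\<close>
    then have "?det (\<alpha> * 2) (\<alpha> * 3) (\<alpha> * 4) (?b * (2 * 2\<^sup>2)) (?b * (2 * 3\<^sup>2)) (?b * (2 * 4\<^sup>2))
        (\<alpha> * 6) (\<alpha> * 10) (\<alpha> * 14) \<ge> 0"
      by (rule tendsto_lowerbound) (auto intro!: eventually_mono[OF eventually_at_right_less] Q_nonneg)
    then have "\<alpha>\<^sup>2 * (\<alpha> * (\<alpha> - 1)) \<le> 0" by (simp add: power2_eq_square field_simps)
    moreover have "\<alpha>\<^sup>2 * (\<alpha> * (\<alpha> - 1)) > 0" using \<open>\<not> \<alpha> \<le> 1\<close> by simp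
    ultimately show False by simp
  qed
  ultimately show ?thesis by simp
qed

section \<open>Preservers on the grid\<close>

text \<open>Weak monotonicity suffices: if a map identifies two points of a tuple, the minor has
  equal rows or columns and vanishes; otherwise the image tuples are strictly increasing.\<close>

lemma totally_nonneg_kernel_pullback:
  assumes K: "totally_nonneg_kernel X Y K" and \<mu>: "\<mu> \<in> X' \<rightarrow> X" "mono_on X' \<mu>"
    and \<nu>: "\<nu> \<in> Y' \<rightarrow> Y" "mono_on Y' \<nu>"
  shows "totally_nonneg_kernel X' Y' (\<lambda>x y. K (\<mu> x) (\<nu> y))"
  unfolding totally_nonneg_kernel_def
proof (intro allI impI)
  fix n x y assume x: "increasing_tuple n X' x" and y: "increasing_tuple n Y' y"
  let ?M = "mat n n (\<lambda>(i, j). K (\<mu> (x i)) (\<nu> (y j)))"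
  have mono: "\<mu> (x i) \<le> \<mu> (x j)" "\<nu> (y i) \<le> \<nu> (y j)" if "i < j" "j < n" for i j
    using x y \<mu> \<nu> that by (auto simp: increasing_tuple_def strict_mono_on_def mono_on_def Pi_iff less_imp_le)
  show "det ?M \<ge> 0"
  proof (cases "\<exists>i j. i < j \<and> j < n \<and> (\<mu> (x i) = \<mu> (x j) \<or> \<nu> (y i) = \<nu> (y j))")
    case True
    then obtain i j where ij: "i < j" "j < n" "\<mu> (x i) = \<mu> (x j) \<or> \<nu> (y i) = \<nu> (y j)" by blast
    from ij(3) have "det ?M = 0"
    proof
      assume "\<mu> (x i) = \<mu> (x j)"
      with ij show ?thesis by (intro det_identical_rows[of _ n i j]) auto
    next
      assume "\<nu> (y i) = \<nu> (y j)"
      with ij show ?thesis by (intro det_identical_columns[of _ n i j]) auto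
    qed
    then show ?thesis by simp
  next
    case False
    then have "\<mu> (x i) < \<mu> (x j)" "\<nu> (y i) < \<nu> (y j)" if "i < j" "j < n" for i j
      using mono[OF that] that by (auto simp: order_le_less)
    then have "increasing_tuple n X (\<lambda>i. \<mu> (x i))" "increasing_tuple n Y (\<lambda>j. \<nu> (y j))"
      using x y \<mu> \<nu> by (auto simp: increasing_tuple_def strict_mono_on_def Pi_iff)
    then show ?thesis using K unfolding totally_nonneg_kernel_def by blast
  qed
qed

lemma totally_nonneg_kernel_cong:
  assumes "totally_nonneg_kernel X Y K" "\<And>x y. x \<in> X \<Longrightarrow> y \<in> Y \<Longrightarrow> L x y = K x y"
  shows "totally_nonneg_kernel X Y L"
  unfolding totally_nonneg_kernel_def
proof (intro allI impI)
  fix n x y assume xy: "increasing_tuple n X x" "increasing_tuple n Y y"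
  then have "det (mat n n (\<lambda>(i, j). L (x i) (y j))) = det (mat n n (\<lambda>(i, j). K (x i) (y j)))"
    by (intro det_mat_cong) (auto simp: assms(2) increasing_tuple_def Pi_iff)
  with assms(1) xy show "det (mat n n (\<lambda>(i, j). L (x i) (y j))) \<ge> 0"
    by (simp add: totally_nonneg_kernel_def)
qed

lemma totally_positive_kernel_cong:
  assumes "totally_positive_kernel X Y K" "\<And>x y. x \<in> X \<Longrightarrow> y \<in> Y \<Longrightarrow> L x y = K x y"
  shows "totally_positive_kernel X Y L"
  unfolding totally_positive_kernel_def
proof (intro allI impI)
  fix n x y assume xy: "increasing_tuple n X x" "increasing_tuple n Y y"
  then have "det (mat n n (\<lambda>(i, j). L (x i) (y j))) = det (mat n n (\<lambda>(i, j). K (x i) (y j)))"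
    by (intro det_mat_cong) (auto simp: assms(2) increasing_tuple_def Pi_iff)
  with assms(1) xy show "det (mat n n (\<lambda>(i, j). L (x i) (y j))) > 0"
    by (simp add: totally_positive_kernel_def)
qed

lemma totally_nonneg_kernel_nonneg:
  assumes "totally_nonneg_kernel X Y K" "x \<in> X" "y \<in> Y"
  shows "K x y \<ge> 0"
proof -
  have "increasing_tuple (Suc 0) X (\<lambda>_. x)" "increasing_tuple (Suc 0) Y (\<lambda>_. y)"
    using assms by (auto simp: increasing_tuple_def strict_mono_on_def)
  with assms(1) have "det (mat (Suc 0) (Suc 0) (\<lambda>(i, j). K x y)) \<ge> 0"
    unfolding totally_nonneg_kernel_def by blast
  then show ?thesis by (simp add: det_mat_1)
qed

text \<open>All larger bounds are included so that a row tuple and a column tuple can share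
  one.\<close>

lemma increasing_tuple_bounded:
  fixes x :: "nat \<Rightarrow> nat"
  assumes "increasing_tuple n UNIV x"
  obtains m where "\<And>m'. m \<le> m' \<Longrightarrow> increasing_tuple n {..<m'} x"
proof -
  obtain m where "x ` {..<n} \<subseteq> {..<m}" using finite_nat_bounded[of "x ` {..<n}"] by auto
  then show thesis using assms by (intro that[of m]) (fastforce simp: increasing_tuple_def)
qed

lemma totally_nonneg_kernel_nat:
  assumes "\<And>m. totally_nonneg_kernel {..<m} {..<m} M"
  shows "totally_nonneg_kernel (UNIV :: nat set) (UNIV :: nat set) M"
  unfolding totally_nonneg_kernel_def
proof (intro allI impI)
  fix n and x y :: "nat \<Rightarrow> nat"
  assume xy: "increasing_tuple n UNIV x" "increasing_tuple n UNIV y"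
  obtain k l where "\<And>m. k \<le> m \<Longrightarrow> increasing_tuple n {..<m} x" "\<And>m. l \<le> m \<Longrightarrow> increasing_tuple n {..<m} y"
    using increasing_tuple_bounded[OF xy(1)] increasing_tuple_bounded[OF xy(2)] by metis
  then have "increasing_tuple n {..<max k l} x" "increasing_tuple n {..<max k l} y" by simp_all
  with assms show "det (mat n n (\<lambda>(i, j). M (x i) (y j))) \<ge> 0"
    unfolding totally_nonneg_kernel_def by blast
qed

lemma totally_positive_kernel_nat:
  assumes "\<And>m. totally_positive_kernel {..<m} {..<m} M"
  shows "totally_positive_kernel (UNIV :: nat set) (UNIV :: nat set) M"
  unfolding totally_positive_kernel_def
proof (intro allI impI)
  fix n and x y :: "nat \<Rightarrow> nat"
  assume xy: "increasing_tuple n UNIV x" "increasing_tuple n UNIV y"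
  obtain k l where "\<And>m. k \<le> m \<Longrightarrow> increasing_tuple n {..<m} x" "\<And>m. l \<le> m \<Longrightarrow> increasing_tuple n {..<m} y"
    using increasing_tuple_bounded[OF xy(1)] increasing_tuple_bounded[OF xy(2)] by metis
  then have "increasing_tuple n {..<max k l} x" "increasing_tuple n {..<max k l} y" by simp_all
  with assms show "det (mat n n (\<lambda>(i, j). M (x i) (y j))) > 0"
    unfolding totally_positive_kernel_def by blast
qed

lemma totally_nonneg_kernel_symmetric_2:
  fixes a b d :: real
  assumes "a \<ge> 0" "b \<ge> 0" "d \<ge> 0" "b\<^sup>2 \<le> a * d"
  shows "totally_nonneg_kernel {..<2::nat} {..<2::nat} (\<lambda>i j. if i \<noteq> j then b else if i = 0 then a else d)"
  unfolding totally_nonneg_kernel_def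
proof (intro allI impI)
  fix n and x y :: "nat \<Rightarrow> nat"
  let ?K = "\<lambda>i j :: nat. if i \<noteq> j then b else if i = 0 then a else d"
  assume x: "increasing_tuple n {..<2} x" and y: "increasing_tuple n {..<2} y"
  have "card {..<n} \<le> card {..<2::nat}"
    using x by (intro card_inj_on_le[of x]) (auto simp: increasing_tuple_def intro: strict_mono_on_imp_inj_on)
  then consider "n = 0" | "n = Suc 0" | "n = 2" by force
  then show "det (mat n n (\<lambda>(i, j). ?K (x i) (y j))) \<ge> 0"
  proof cases
    case 3
    have "z 0 = 0 \<and> z 1 = 1" if "increasing_tuple n {..<2} z" for z :: "nat \<Rightarrow> nat"
    proof -
      have "z 0 < z 1" "z 1 < 2"
        using that 3 by (auto simp: increasing_tuple_def strict_mono_on_def)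
      then show ?thesis by auto
    qed
    from this[OF x] this[OF y] show ?thesis
      unfolding 3 using assms by (simp add: det_mat_2 power2_eq_square)
  qed (use assms in \<open>simp_all add: det_mat_1\<close>)
qed

text \<open>The common core of both preserver problems. Constants remain because they turn every
  minor of size at least 2 into 0; strict positivity or the value at 0 must exclude them.\<close>

lemma positive_preserver_cases:
  fixes F :: "real \<Rightarrow> real"
  assumes pos: "\<And>x. x > 0 \<Longrightarrow> F x > 0"
    and preserves: "\<And>K. symmetric_kernel (UNIV :: real set) K \<Longrightarrow> totally_positive_kernel UNIV UNIV K \<Longrightarrow>
      totally_nonneg_kernel (UNIV :: nat set) UNIV (\<lambda>i j. F (K (real i) (real j)))"
  obtains c where "c > 0" "\<And>x. x > 0 \<Longrightarrow> F x = c * x"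
  | c where "c > 0" "\<And>x. x > 0 \<Longrightarrow> F x = c"
proof -
  have super: "F b * F c \<le> F a * F d" if abcd: "a > 0" "b > 0" "c > 0" "d > 0" "b * c < a * d" for a b c d
  proof -
    obtain K where K: "symmetric_kernel (UNIV :: real set) K" "totally_positive_kernel UNIV UNIV K"
      "K 1 3 = a" "K 1 4 = b" "K 2 3 = c" "K 2 4 = d"
      using symmetric_totally_positive_kernel_block[OF abcd] by blast
    show ?thesis
      using totally_nonneg_kernel_2[OF preserves[OF K(1,2)], of 1 2 3 4] K(3-) by simp
  qed
  have "\<exists>c>0. \<exists>\<alpha>\<ge>0. \<forall>x>0. F x = c * x powr \<alpha>"
    by (rule power_function_if_supermodular[OF pos super])
  then obtain c \<alpha> where c: "c > 0" "\<alpha> \<ge> 0" and F: "\<forall>x>0. F x = c * x powr \<alpha>"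
    by blast
  show thesis
  proof (cases "\<alpha> = 0")
    case True
    with F have "F x = c" if "x > 0" for x using that by simp
    with c(1) show thesis by (rule that(2))
  next
    case False
    have "\<alpha> = 1"
    proof (rule exponent_eq_1_if_preserves[where c = c])
      fix K assume K: "symmetric_kernel (UNIV :: real set) K" "totally_positive_kernel UNIV UNIV K"
      show "totally_nonneg_kernel (UNIV :: nat set) UNIV (\<lambda>i j. c * K (real i) (real j) powr \<alpha>)"
      proof (rule totally_nonneg_kernel_cong[OF preserves[OF K]])
        fix i j :: nat
        show "c * K (real i) (real j) powr \<alpha> = F (K (real i) (real j))"
          using F totally_positive_kernel_pos[OF K(2)] by simp
      qed
    qed (use c False in auto)
    with F have "F x = c * x" if "x > 0" for x using that by simp
    with c(1) show thesis by (rule that(1))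
  qed
qed

lemma linear_if_totally_positive_preserver:
  fixes F :: "real \<Rightarrow> real"
  assumes pos: "\<And>x. x > 0 \<Longrightarrow> F x > 0"
    and preserves: "\<And>K. symmetric_kernel (UNIV :: real set) K \<Longrightarrow> totally_positive_kernel UNIV UNIV K \<Longrightarrow>
      totally_positive_kernel (UNIV :: nat set) UNIV (\<lambda>i j. F (K (real i) (real j)))"
  shows "\<exists>c>0. \<forall>x>0. F x = c * x"
proof (rule positive_preserver_cases[OF pos totally_positive_imp_nonneg_kernel[OF preserves]])
  fix c assume c: "\<And>x. x > 0 \<Longrightarrow> F x = c"
  \<comment> \<open>A block with positive minor on which a constant \<open>F\<close> produces minor
    0.\<close>
  obtain K where K: "symmetric_kernel (UNIV :: real set) K" "totally_positive_kernel UNIV UNIV K"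
    "K 1 3 = 2" "K 1 4 = 1" "K 2 3 = 1" "K 2 4 = 2"
    using symmetric_totally_positive_kernel_block[of 2 1 1 2] by auto
  have "F 1 * F 1 < F 2 * F 2"
    using totally_positive_kernel_2[OF preserves[OF K(1,2)], of 1 2 3 4] K(3-) by simp
  with c show ?thesis by simp
qed blast+

text \<open>Symmetric \<open>2 \<times> 2\<close> matrices make \<open>F\<close> non-negative,
  monotone and positive off 0, which reduces the problem to \<open>positive_preserver_cases\<close>;
  what remains is the value at 0.\<close>

lemma linear_if_totally_nonneg_preserver:
  fixes F :: "real \<Rightarrow> real"
  assumes nonconst: "\<exists>s\<ge>0. \<exists>t\<ge>0. F s \<noteq> F t"
    and preserves: "\<And>m A. symmetric_kernel {..<m::nat} A \<Longrightarrow> totally_nonneg_kernel {..<m} {..<m} A \<Longrightarrow>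
      totally_nonneg_kernel {..<m} {..<m} (\<lambda>i j. F (A i j))"
  shows "\<exists>c>0. \<forall>x\<ge>0. F x = c * x"
proof -
  have two: "F b \<ge> 0" "(F b)\<^sup>2 \<le> F a * F d" if abd: "a \<ge> 0" "b \<ge> 0" "d \<ge> 0" "b\<^sup>2 \<le> a * d" for a b d
  proof -
    let ?A = "\<lambda>i j :: nat. if i \<noteq> j then b else if i = 0 then a else d"
    have TN: "totally_nonneg_kernel {..<2} {..<2} (\<lambda>i j. F (?A i j))"
      by (intro preserves totally_nonneg_kernel_symmetric_2 abd) (simp add: symmetric_kernel_def)
    show "F b \<ge> 0" using totally_nonneg_kernel_nonneg[OF TN, of 0 1] by simp
    show "(F b)\<^sup>2 \<le> F a * F d"
      using totally_nonneg_kernel_2[OF TN, of 0 1 0 1] by (simp add: power2_eq_square)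
  qed
  have nonneg: "F x \<ge> 0" if "x \<ge> 0" for x using two(1)[of x x x] that by (simp add: power2_eq_square)
  have mono: "F x \<le> F y" if "0 \<le> x" "x \<le> y" for x y
  proof (rule power2_le_imp_le)
    \<comment> \<open>Test matrix with diagonal \<open>y, y\<close> and off-diagonal entry
      \<open>x\<close>.\<close>
    have "x\<^sup>2 \<le> y * y" using that by (simp add: power2_eq_square mult_mono)
    then show "(F x)\<^sup>2 \<le> (F y)\<^sup>2" using two(2)[of y x y] that by (simp add: power2_eq_square)
  qed (use nonneg that in auto)
  have pos: "F x > 0" if "x > 0" for x
  proof (rule ccontr)
    assume "\<not> F x > 0"
    with nonneg[of x] that have "F x = 0" by simp
    \<comment> \<open>Every \<open>b\<close> is the off-diagonal entry of a singular test matrix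
      with diagonal \<open>x, b\<^sup>2 / x\<close>, so one positive zero would make
      \<open>F\<close> vanish on \<open>{0..}\<close>.\<close>
    then have "F b = 0" if "b \<ge> 0" for b
      using two(2)[of x b "b\<^sup>2 / x"] that \<open>x > 0\<close> by simp
    with nonconst show False by auto
  qed
  have sym_real: "totally_nonneg_kernel (UNIV :: nat set) UNIV (\<lambda>i j. K (real i) (real j))"
    if "totally_positive_kernel (UNIV :: real set) UNIV K" for K
    by (rule totally_positive_imp_nonneg_kernel[OF totally_positive_kernel_pullback[OF that]])
      (auto simp: strict_mono_on_def)
  have preserves_real: "totally_nonneg_kernel (UNIV :: nat set) UNIV (\<lambda>i j. F (K (real i) (real j)))"
    if "symmetric_kernel (UNIV :: real set) K" "totally_positive_kernel UNIV UNIV K" for K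
  proof (rule totally_nonneg_kernel_nat)
    fix m
    show "totally_nonneg_kernel {..<m} {..<m} (\<lambda>i j. F (K (real i) (real j)))"
      using that(1)
      by (intro preserves totally_nonneg_kernel_pullback[OF sym_real[OF that(2)], of "\<lambda>i. i" _ "\<lambda>i. i"])
        (auto simp: symmetric_kernel_def mono_on_def)
  qed
  show ?thesis
  proof (rule positive_preserver_cases[OF pos preserves_real])
    fix c assume c: "c > 0" "\<And>x. x > 0 \<Longrightarrow> F x = c * x"
    \<comment> \<open>At \<open>x = F 0 / (2 * c)\<close> a positive \<open>F 0\<close> would be at
      most its own half.\<close>
    have "F 0 \<le> c * x" if "x > 0" for x using mono[of 0 x] c(2)[OF that] that by simp
    from this[of "F 0 / (2 * c)"] nonneg[of 0] \<open>c > 0\<close> have "F 0 = 0"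
      by (cases "F 0 = 0") (auto simp: field_simps)
    then have "F x = c * x" if "x \<ge> 0" for x using c(2)[of x] that by (cases "x = 0") auto
    with \<open>c > 0\<close> show ?thesis by blast
  next
    fix c assume c: "c > 0" "\<And>x. x > 0 \<Longrightarrow> F x = c"
    have "F 0 \<noteq> c"
    proof
      assume "F 0 = c"
      then have "F x = c" if "x \<ge> 0" for x using c(2)[of x] that by (cases "x = 0") auto
      with nonconst show False by auto
    qed
    let ?A = "fold_kernel [0, 1] 3 (\<lambda>k. if k < 2 then 1 else 0) (\<lambda>k i :: nat. of_bool (i = k))"
    let ?T = "\<lambda>i j :: nat. if i = j then if i = 1 then 2 else 1 else if i + j = 2 then 0 else 1 :: real"
    \<comment> \<open>With the identity as \<open>G\<close>, the approximation theorem shows that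
      the tridiagonal matrix itself is totally non-negative.\<close>
    have "totally_nonneg_kernel UNIV UNIV (\<lambda>i j. id (?A i j))"
      by (rule totally_nonneg_kernel_fold_kernel) (auto simp: sym_real)
    then have "totally_nonneg_kernel {..<3} {..<3} ?A"
      using totally_nonneg_kernel_pullback[of UNIV UNIV ?A "\<lambda>i. i" "{..<3}" "\<lambda>i. i" "{..<3}"]
      by (simp add: mono_on_def)
    then have "totally_nonneg_kernel {..<3} {..<3} ?T"
      by (rule totally_nonneg_kernel_cong) (simp only: lessThan_iff tridiagonal_fold_kernel)
    then have "totally_nonneg_kernel {..<3} {..<3} (\<lambda>i j. F (?T i j))"
      by (intro preserves) (auto simp: symmetric_kernel_def)
    moreover have "increasing_tuple 3 {..<3} (\<lambda>i :: nat. i)"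
      by (simp add: increasing_tuple_def strict_mono_on_def)
    ultimately have "0 \<le> det (mat 3 3 (\<lambda>(i, j). F (?T i j)))"
      unfolding totally_nonneg_kernel_def by blast
    \<comment> \<open>Only the two corners of \<open>?T\<close> are 0, so the image has
      \<open>F 0\<close> there and \<open>c\<close> elsewhere.\<close>
    also have "\<dots> = - (c * (c - F 0)\<^sup>2)"
      using c(2)[of 1] c(2)[of 2] by (simp add: det_mat_3 power2_eq_square algebra_simps)
    also have "\<dots> < 0" using \<open>F 0 \<noteq> c\<close> \<open>c > 0\<close> by simp
    finally show ?thesis by simp
  qed
qed

section \<open>Reduction to the grid\<close>

lemma infinite_increasing_tuple:
  assumes "infinite X"
  obtains x where "increasing_tuple n X x"
proof -
  obtain S where S: "S \<subseteq> X" "finite S" "card S = n"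
    using infinite_arbitrarily_large[OF assms] by blast
  then have "sorted_list_of_set S ! i \<in> X" if "i < n" for i
    using that nth_mem[of i "sorted_list_of_set S"] by auto
  then show thesis
    using strict_mono_on_nth_sorted_list_of_set[OF S(2)] S(3)
    by (intro that[of "nth (sorted_list_of_set S)"]) (auto simp: increasing_tuple_def)
qed

text \<open>The integer part counts the grid points up to \<open>a\<close>, and \<open>h\<close>
  orders the points strictly between neighbours. The count at \<open>x i\<close> is
  \<open>i + 1\<close>, hence the \<open>- 1\<close> in the map.\<close>

lemma strict_mono_embedding_through_grid:
  fixes h :: "'a::linorder \<Rightarrow> real"
  assumes x: "increasing_tuple n X x" and h: "h \<in> X \<rightarrow> {0<..<1}" "strict_mono_on X h"
  obtains \<phi> :: "'a \<Rightarrow> real" where "strict_mono_on X \<phi>" "\<forall>i<n. \<phi> (x i) = real i"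
proof -
  define N where "N a = card {i. i < n \<and> x i \<le> a}" for a
  define \<theta> where "\<theta> a = (if a \<in> x ` {..<n} then 0 else h a)" for a
  let ?\<phi> = "\<lambda>a. real (N a) + \<theta> a - 1"
  have N_mono: "N a \<le> N b" if "a \<le> b" for a b
    unfolding N_def using that by (intro card_mono) auto
  have \<theta>: "0 \<le> \<theta> a" "\<theta> a < 1" if "a \<in> X" for a using h(1) that by (auto simp: \<theta>_def Pi_iff)
  show thesis
  proof
    show "strict_mono_on X ?\<phi>"
    proof (rule strict_mono_onI)
      fix a b assume ab: "a \<in> X" "b \<in> X" "a < b"
      show "?\<phi> a < ?\<phi> b"
      proof (cases "N a = N b")
        case True
        \<comment> \<open>A grid point \<open>b\<close> would be counted by \<open>N b\<close> but
          not by \<open>N a\<close>.\<close>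
        have "b \<notin> x ` {..<n}"
        proof
          assume "b \<in> x ` {..<n}"
          then obtain i where "i < n" "b = x i" by auto
          then have "i \<in> {i. i < n \<and> x i \<le> b} - {i. i < n \<and> x i \<le> a}" using ab(3) by simp
          moreover have "{i. i < n \<and> x i \<le> a} \<subseteq> {i. i < n \<and> x i \<le> b}" using ab(3) by auto
          ultimately have "{i. i < n \<and> x i \<le> a} \<subset> {i. i < n \<and> x i \<le> b}" by blast
          then have "N a < N b" unfolding N_def by (intro psubset_card_mono) auto
          with True show False by simp
        qed
        then have "\<theta> a < \<theta> b"
          using ab h strict_mono_onD[OF h(2) ab] by (auto simp: \<theta>_def Pi_iff)
        with True show ?thesis by simp
      next
        case False
        with N_mono[of a b] ab have "N a + 1 \<le> N b" by (simp add: less_imp_le)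
        with \<theta>[OF ab(1)] \<theta>[OF ab(2)] show ?thesis by linarith
      qed
    qed
    show "\<forall>i<n. ?\<phi> (x i) = real i"
    proof (intro allI impI)
      fix i assume "i < n"
      have "x j \<le> x i \<longleftrightarrow> j \<le> i" if "j < n" for j
        using x that \<open>i < n\<close> strict_mono_on_less_eq[of "{..<n}" x j i]
        unfolding increasing_tuple_def by blast
      then have "{j. j < n \<and> x j \<le> x i} = {..i}" using \<open>i < n\<close> by auto
      then show "?\<phi> (x i) = real i" using \<open>i < n\<close> by (simp add: N_def \<theta>_def)
    qed
  qed
qed

text \<open>A step function counting the grid points up to \<open>a\<close>. The point
  \<open>x 0\<close> is left out of the count, which keeps the values below \<open>m\<close> and
  sends everything before \<open>x 1\<close> to 0.\<close>

lemma mono_map_through_grid: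
  assumes x: "increasing_tuple m X x" and "m > 0"
  obtains \<mu> :: "'a::linorder \<Rightarrow> nat" where "mono_on X \<mu>" "\<mu> \<in> X \<rightarrow> {..<m}" "\<forall>i<m. \<mu> (x i) = i"
proof
  let ?\<mu> = "\<lambda>a. card {i. 0 < i \<and> i < m \<and> x i \<le> a}"
  show "mono_on X ?\<mu>" by (intro mono_onI card_mono) auto
  have "?\<mu> a < m" for a
  proof -
    have "?\<mu> a \<le> card {1..<m}" by (intro card_mono) auto
    with \<open>m > 0\<close> show ?thesis by simp
  qed
  then show "?\<mu> \<in> X \<rightarrow> {..<m}" by simp
  show "\<forall>i<m. ?\<mu> (x i) = i"
  proof (intro allI impI)
    fix i assume "i < m"
    have "x j \<le> x i \<longleftrightarrow> j \<le> i" if "j < m" for j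
      using x that \<open>i < m\<close> strict_mono_on_less_eq[of "{..<m}" x j i]
        unfolding increasing_tuple_def by blast
    then have "{j. 0 < j \<and> j < m \<and> x j \<le> x i} = {1..i}" using \<open>i < m\<close> by auto
    then show "?\<mu> (x i) = i" by simp
  qed
qed

lemma totally_positive_kernel_transpose:
  assumes "totally_positive_kernel X Y K"
  shows "totally_positive_kernel Y X (\<lambda>y x. K x y)"
  unfolding totally_positive_kernel_def
proof (intro allI impI)
  fix n x y assume "increasing_tuple n Y y" "increasing_tuple n X x"
  then have "det (mat n n (\<lambda>(i, j). K (x i) (y j))) > 0"
    using assms unfolding totally_positive_kernel_def by blast
  moreover have "mat n n (\<lambda>(i, j). K (x j) (y i)) = (mat n n (\<lambda>(i, j). K (x i) (y j)))\<^sup>T"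
    by (rule eq_matI) auto
  ultimately show "det (mat n n (\<lambda>(i, j). K (x j) (y i))) > 0" by (simp add: det_transpose[where n = n])
qed

text \<open>Positive \<open>2 \<times> 2\<close> minors make the ratio of two columns strictly
  increasing; \<open>?h\<close> is this ratio \<open>u\<close> normalised to
  \<open>u / (1 + u)\<close>.\<close>

lemma totally_positive_kernel_imp_embedding:
  fixes X :: "'a::linorder set" and Y :: "'b::linorder set"
  assumes K: "totally_positive_kernel X Y K" and "infinite Y"
  obtains h :: "'a \<Rightarrow> real" where "h \<in> X \<rightarrow> {0<..<1}" "strict_mono_on X h"
proof -
  obtain y where "increasing_tuple 2 Y y" using infinite_increasing_tuple[OF \<open>infinite Y\<close>] .
  then have y: "y 0 \<in> Y" "y 1 \<in> Y" "y 0 < y 1" by (auto simp: increasing_tuple_def strict_mono_on_def)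
  have pos: "K a (y 0) > 0" "K a (y 1) > 0" if "a \<in> X" for a
    using totally_positive_kernel_pos[OF K that] y by auto
  let ?h = "\<lambda>a. K a (y 1) / (K a (y 0) + K a (y 1))"
  show thesis
  proof
    show "?h \<in> X \<rightarrow> {0<..<1}" using pos by (auto simp: add_pos_pos)
    show "strict_mono_on X ?h"
    proof (rule strict_mono_onI)
      fix a b assume ab: "a \<in> X" "b \<in> X" "a < b"
      have "K a (y 1) * K b (y 0) < K a (y 0) * K b (y 1)"
        by (rule totally_positive_kernel_2[OF K ab y])
      then show "?h a < ?h b" using pos ab by (simp add: frac_less_eq divide_less_eq less_divide_eq add_pos_pos algebra_simps)
    qed
  qed
qed

section \<open>Linear functions as preservers, and transfer back to the grid\<close>

lemma totally_positive_kernel_linear: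
  assumes "totally_positive_kernel X Y K" "c > 0" "\<And>x. x > 0 \<Longrightarrow> F x = c * x"
  shows "totally_positive_kernel X Y (\<lambda>x y. F (K x y))"
proof (rule totally_positive_kernel_cong)
  show "totally_positive_kernel X Y (\<lambda>x y. c * 1 * K x y)"
    using assms by (intro totally_positive_kernel_scale) auto
qed (use assms totally_positive_kernel_pos[OF assms(1)] in auto)

lemma totally_nonneg_kernel_linear:
  assumes "totally_nonneg_kernel X Y K" "c > 0" "\<And>x. x \<ge> 0 \<Longrightarrow> F x = c * x"
  shows "totally_nonneg_kernel X Y (\<lambda>x y. F (K x y))"
proof (rule totally_nonneg_kernel_cong)
  have "det (mat n n (\<lambda>(i, j). c * K (x i) (y j))) = c ^ n * det (mat n n (\<lambda>(i, j). K (x i) (y j)))" for n x y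
    using det_scale_rows_columns[of n "\<lambda>_. c" "\<lambda>_. 1"] by simp
  then show "totally_nonneg_kernel X Y (\<lambda>x y. c * K x y)"
    using assms(1,2) by (simp add: totally_nonneg_kernel_def)
qed (use assms totally_nonneg_kernel_nonneg[OF assms(1)] in auto)

lemma totally_positive_kernel_grid:
  assumes x: "increasing_tuple m X x" and y: "increasing_tuple m Y y"
    and \<phi>: "\<forall>i<m. \<phi> (x i) = real i" and \<psi>: "\<forall>j<m. \<psi> (y j) = real j"
    and "totally_positive_kernel X Y (\<lambda>a b. L (\<phi> a) (\<psi> b))"
  shows "totally_positive_kernel {..<m} {..<m} (\<lambda>i j. L (real i) (real j))"
proof (rule totally_positive_kernel_cong)
  show "totally_positive_kernel {..<m} {..<m} (\<lambda>i j. L (\<phi> (x i)) (\<psi> (y j)))"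
    using x y by (intro totally_positive_kernel_pullback[OF assms(5)]) (auto simp: increasing_tuple_def)
qed (simp add: \<phi> \<psi>)

lemma totally_nonneg_kernel_grid:
  assumes x: "increasing_tuple m X x" and y: "increasing_tuple m Y y"
    and \<mu>: "\<forall>i<m. \<mu> (x i) = i" and \<nu>: "\<forall>j<m. \<nu> (y j) = j"
    and "totally_nonneg_kernel X Y (\<lambda>a b. L (\<mu> a) (\<nu> b))"
  shows "totally_nonneg_kernel {..<m} {..<m} L"
proof (rule totally_nonneg_kernel_cong)
  show "totally_nonneg_kernel {..<m} {..<m} (\<lambda>i j. L (\<mu> (x i)) (\<nu> (y j)))"
    using x y
    by (intro totally_nonneg_kernel_pullback[OF assms(5)])
      (auto simp: increasing_tuple_def intro: strict_mono_on_imp_mono_on)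
qed (simp add: \<mu> \<nu>)

text \<open>The empty grid is treated separately, as a nonempty set has no map into it.\<close>

lemma totally_nonneg_kernel_0: "totally_nonneg_kernel {..<0::nat} {..<0::nat} A"
  unfolding totally_nonneg_kernel_def
proof (intro allI impI)
  fix n and x y :: "nat \<Rightarrow> nat"
  assume "increasing_tuple n {..<0} x"
  then have "n = 0" by (cases n) (auto simp: increasing_tuple_def Pi_iff)
  then show "0 \<le> det (mat n n (\<lambda>(i, j). A (x i) (y j)))" by simp
qed

theorem theorem1p8:
  fixes X :: "'a::linorder set" and Y :: "'b::linorder set"
  assumes "infinite X" and "infinite Y"
    and "\<exists>K. totally_positive_kernel X Y K"
  shows
    "(\<forall>F :: real \<Rightarrow> real. F \<in> {0<..} \<rightarrow> {0<..} \<longrightarrow>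
        ((\<forall>K. totally_positive_kernel X Y K \<longrightarrow>
              totally_positive_kernel X Y (\<lambda>x y. F (K x y)))
         \<longleftrightarrow> (\<exists>c>0. \<forall>x>0. F x = c * x)))
   \<and> (\<forall>F :: real \<Rightarrow> real. (\<exists>s\<ge>0. \<exists>t\<ge>0. F s \<noteq> F t) \<longrightarrow>
        ((\<forall>K. totally_nonneg_kernel X Y K \<longrightarrow>
              totally_nonneg_kernel X Y (\<lambda>x y. F (K x y)))
         \<longleftrightarrow> (\<exists>c>0. \<forall>x\<ge>0. F x = c * x)))
   \<and> (\<forall>F :: real \<Rightarrow> real. F \<in> {0<..} \<rightarrow> {0<..} \<longrightarrow>
        ((\<forall>K. symmetric_kernel X K \<and> totally_positive_kernel X X K \<longrightarrow>
              totally_positive_kernel X X (\<lambda>x y. F (K x y)))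
         \<longleftrightarrow> (\<exists>c>0. \<forall>x>0. F x = c * x)))
   \<and> (\<forall>F :: real \<Rightarrow> real. (\<exists>s\<ge>0. \<exists>t\<ge>0. F s \<noteq> F t) \<longrightarrow>
        ((\<forall>K. symmetric_kernel X K \<and> totally_nonneg_kernel X X K \<longrightarrow>
              totally_nonneg_kernel X X (\<lambda>x y. F (K x y)))
         \<longleftrightarrow> (\<exists>c>0. \<forall>x\<ge>0. F x = c * x)))"
proof -
  obtain K0 where K0: "totally_positive_kernel X Y K0" using assms(3) by blast
  \<comment> \<open>The given kernel embeds \<open>X\<close> through two of its columns, and its
    transpose embeds \<open>Y\<close>.\<close>
  obtain hX :: "'a \<Rightarrow> real" where hX: "hX \<in> X \<rightarrow> {0<..<1}" "strict_mono_on X hX"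
    by (rule totally_positive_kernel_imp_embedding[OF K0 assms(2)])
  obtain hY :: "'b \<Rightarrow> real" where hY: "hY \<in> Y \<rightarrow> {0<..<1}" "strict_mono_on Y hY"
    by (rule totally_positive_kernel_imp_embedding[OF totally_positive_kernel_transpose[OF K0] assms(1)])
  \<comment> \<open>A kernel on the reals is pulled back to \<open>X \<times> Y\<close>, the
    hypothesis on \<open>F\<close> is applied there, and the result is read off at the tuples sent
    to the grid.\<close>
  have linear_TP: "\<exists>c>0. \<forall>x>0. F x = c * x"
    if F: "F \<in> {0<..} \<rightarrow> {0<..}"
      and P: "\<forall>K. totally_positive_kernel X Y K \<longrightarrow> totally_positive_kernel X Y (\<lambda>x y. F (K x y))" for F
  proof (rule linear_if_totally_positive_preserver)
    fix K assume K: "symmetric_kernel (UNIV :: real set) K" "totally_positive_kernel UNIV UNIV K"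
    show "totally_positive_kernel UNIV UNIV (\<lambda>i j. F (K (real i) (real j)))"
    proof (rule totally_positive_kernel_nat)
      fix m
      obtain x where x: "increasing_tuple m X x" by (rule infinite_increasing_tuple[OF assms(1)])
      obtain y where y: "increasing_tuple m Y y" by (rule infinite_increasing_tuple[OF assms(2)])
      obtain \<phi> where \<phi>: "strict_mono_on X \<phi>" "\<forall>i<m. \<phi> (x i) = real i"
        by (rule strict_mono_embedding_through_grid[OF x hX])
      obtain \<psi> where \<psi>: "strict_mono_on Y \<psi>" "\<forall>i<m. \<psi> (y i) = real i"
        by (rule strict_mono_embedding_through_grid[OF y hY])
      have "totally_positive_kernel X Y (\<lambda>a b. K (\<phi> a) (\<psi> b))"
        by (rule totally_positive_kernel_pullback[OF K(2)]) (use \<phi> \<psi> in auto)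
      with P show "totally_positive_kernel {..<m} {..<m} (\<lambda>i j. F (K (real i) (real j)))"
        by (intro totally_positive_kernel_grid[OF x y \<phi>(2) \<psi>(2), where L = "\<lambda>u v. F (K u v)"]) auto
    qed
  qed (use F in auto)
  have linear_TN: "\<exists>c>0. \<forall>x\<ge>0. F x = c * x"
    if F: "\<exists>s\<ge>0. \<exists>t\<ge>0. F s \<noteq> F t"
      and P: "\<forall>K. totally_nonneg_kernel X Y K \<longrightarrow> totally_nonneg_kernel X Y (\<lambda>x y. F (K x y))"
    for F :: "real \<Rightarrow> real"
  proof (rule linear_if_totally_nonneg_preserver[OF F])
    fix m A assume A: "symmetric_kernel {..<m::nat} A" "totally_nonneg_kernel {..<m} {..<m} A"
    show "totally_nonneg_kernel {..<m} {..<m} (\<lambda>i j. F (A i j))"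
    proof (cases "m = 0")
      case True
      then show ?thesis using totally_nonneg_kernel_0 by simp
    next
      case False
      then have m: "m > 0" by simp
      obtain x where x: "increasing_tuple m X x" by (rule infinite_increasing_tuple[OF assms(1)])
      obtain y where y: "increasing_tuple m Y y" by (rule infinite_increasing_tuple[OF assms(2)])
      obtain \<mu> where \<mu>: "mono_on X \<mu>" "\<mu> \<in> X \<rightarrow> {..<m}" "\<forall>i<m. \<mu> (x i) = i"
        by (rule mono_map_through_grid[OF x m])
      obtain \<nu> where \<nu>: "mono_on Y \<nu>" "\<nu> \<in> Y \<rightarrow> {..<m}" "\<forall>i<m. \<nu> (y i) = i"
        by (rule mono_map_through_grid[OF y m])
      have "totally_nonneg_kernel X Y (\<lambda>a b. A (\<mu> a) (\<nu> b))"
        by (rule totally_nonneg_kernel_pullback[OF A(2) \<mu>(2,1) \<nu>(2,1)])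
      with P show ?thesis
        by (intro totally_nonneg_kernel_grid[OF x y \<mu>(3) \<nu>(3), where L = "\<lambda>u v. F (A u v)"]) auto
    qed
  qed
  \<comment> \<open>Using one map for both variables keeps the pulled-back kernel symmetric.\<close>
  have linear_symmetric_TP: "\<exists>c>0. \<forall>x>0. F x = c * x"
    if F: "F \<in> {0<..} \<rightarrow> {0<..}"
      and P: "\<forall>K. symmetric_kernel X K \<and> totally_positive_kernel X X K \<longrightarrow>
        totally_positive_kernel X X (\<lambda>x y. F (K x y))" for F
  proof (rule linear_if_totally_positive_preserver)
    fix K assume K: "symmetric_kernel (UNIV :: real set) K" "totally_positive_kernel UNIV UNIV K"
    show "totally_positive_kernel UNIV UNIV (\<lambda>i j. F (K (real i) (real j)))"
    proof (rule totally_positive_kernel_nat)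
      fix m
      obtain x where x: "increasing_tuple m X x" by (rule infinite_increasing_tuple[OF assms(1)])
      obtain \<phi> where \<phi>: "strict_mono_on X \<phi>" "\<forall>i<m. \<phi> (x i) = real i"
        by (rule strict_mono_embedding_through_grid[OF x hX])
      have "totally_positive_kernel X X (\<lambda>a b. K (\<phi> a) (\<phi> b))"
        by (rule totally_positive_kernel_pullback[OF K(2)]) (use \<phi> in auto)
      moreover have "symmetric_kernel X (\<lambda>a b. K (\<phi> a) (\<phi> b))"
        using K(1) by (simp add: symmetric_kernel_def)
      ultimately show "totally_positive_kernel {..<m} {..<m} (\<lambda>i j. F (K (real i) (real j)))"
        using P by (intro totally_positive_kernel_grid[OF x x \<phi>(2) \<phi>(2), where L = "\<lambda>u v. F (K u v)"]) auto
    qed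
  qed (use F in auto)
  have linear_symmetric_TN: "\<exists>c>0. \<forall>x\<ge>0. F x = c * x"
    if F: "\<exists>s\<ge>0. \<exists>t\<ge>0. F s \<noteq> F t"
      and P: "\<forall>K. symmetric_kernel X K \<and> totally_nonneg_kernel X X K \<longrightarrow>
        totally_nonneg_kernel X X (\<lambda>x y. F (K x y))"
    for F :: "real \<Rightarrow> real"
  proof (rule linear_if_totally_nonneg_preserver[OF F])
    fix m A assume A: "symmetric_kernel {..<m::nat} A" "totally_nonneg_kernel {..<m} {..<m} A"
    show "totally_nonneg_kernel {..<m} {..<m} (\<lambda>i j. F (A i j))"
    proof (cases "m = 0")
      case True
      then show ?thesis using totally_nonneg_kernel_0 by simp
    next
      case False
      then have m: "m > 0" by simp
      obtain x where x: "increasing_tuple m X x" by (rule infinite_increasing_tuple[OF assms(1)])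
      obtain \<mu> where \<mu>: "mono_on X \<mu>" "\<mu> \<in> X \<rightarrow> {..<m}" "\<forall>i<m. \<mu> (x i) = i"
        by (rule mono_map_through_grid[OF x m])
      have "totally_nonneg_kernel X X (\<lambda>a b. A (\<mu> a) (\<mu> b))"
        by (rule totally_nonneg_kernel_pullback[OF A(2) \<mu>(2,1) \<mu>(2,1)])
      moreover have "symmetric_kernel X (\<lambda>a b. A (\<mu> a) (\<mu> b))"
        using A(1) \<mu>(2) by (auto simp: symmetric_kernel_def Pi_iff)
      ultimately show ?thesis
        using P by (intro totally_nonneg_kernel_grid[OF x x \<mu>(3) \<mu>(3), where L = "\<lambda>u v. F (A u v)"]) auto
    qed
  qed
  show ?thesis
    by (intro conjI allI impI iffI linear_TP linear_TN linear_symmetric_TP linear_symmetric_TN)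
      (auto intro: totally_positive_kernel_linear totally_nonneg_kernel_linear)
qed

end
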